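(* Let $p=p_n$, $\Delta=\Delta_n$, $s=s_n$ and $D=D_n$ be sequences indexed by $n$, and let $\mathbb{P}_n,\mathbb{Q}_n$ be the planted and null distributions on $\mathbb{R}^{pn}$ defined in the context. If $$\limsup_{n\to\infty}\left[\sqrt{\frac{n\Delta^4}{p}}+\sqrt{\frac{4n\Delta^4D}{s^2}}\right]<1,$$ then, as $n\to\infty$, $$\|L_n^{\le D}\|^2=1+O\left(\frac{n\Delta^4}{p}+\frac{n\Delta^4D}{s^2}\right).$$
   Context: Definition of $\mathbb{P}_n$: draw $z\in\{-1,1\}^n$ and $\theta\in\mathbb{R}^p$ independently, where $z_1,\dots,z_n$ are i.i.d. Rademacher (uniform on $\{-1,1\}$), and $\theta$ is drawn as follows: choose $S$ uniformly at random among subsets of $\{1,\dots,p\}$ of size $s$; given $S$, the entries $\theta_i$ are independent with $\theta_i=\frac{\Delta}{\sqrt s}R_i$, $R_i$ Rademacher, for $i\in S$, and $\theta_i=0$ for $i\notin S$. Then observe $X_i=z_i\theta+\varepsilon_i$, $i=1,\dots,n$, with $\varepsilon_i$ i.i.d. $\mathcal{N}(0,I_p)$ independent of $(\theta,z)$. $\mathbb{P}_n$ is the law of $(X_1,\dots,X_n)\in\mathbb{R}^{pn}$. Definition of $\mathbb{Q}_n$: the law of $(X_1,\dots,X_n)$ with $X_i$ i.i.d. $\mathcal{N}(0,I_p)$ (i.e. $\theta=0$). The quantity $\|L_n^{\le D}\|$ is $$\|L_n^{\le D}\|:=\max_{f:\ \deg f\le D}\frac{\mathbb{E}_{X\sim\mathbb{P}_n}[f(X)]}{\sqrt{\mathbb{E}_{X\sim\mathbb{Q}_n}[f(X)^2]}},$$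 the maximum being over (nonzero) polynomials $f:\mathbb{R}^{pn}\to\mathbb{R}$ of degree at most $D$; equivalently, it is the $L^2(\mathbb{Q}_n)$-norm of the orthogonal projection $L_n^{\le D}$ of the likelihood ratio $L_n=\frac{d\mathbb{P}_n}{d\mathbb{Q}_n}$ onto the space of polynomials of degree at most $D$. Asymptotic notation refers to $n\to\infty$. *)

theory Defs
  imports "HOL-Probability.Probability" "HOL-Library.Landau_Symbols"
begin

(* The data space R^(pn) is the product over {..<n} \<times> {..<p}: the sample X is a function with
   X (i, j) the j-th coordinate of the i-th observation (indices start at 0). *)

abbreviation data_index :: "nat \<Rightarrow> nat \<Rightarrow> (nat \<times> nat) set" where
  "data_index n p \<equiv> {..<n} \<times> {..<p}"

definition null_dist :: "nat \<Rightarrow> nat \<Rightarrow> (nat \<times> nat \<Rightarrow> real) measure" where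
  "null_dist n p = (\<Pi>\<^sub>M ij\<in>data_index n p. density lborel std_normal_density)"

definition rademacher_pmf :: "real pmf" where
  "rademacher_pmf = pmf_of_set {-1, 1}"

definition label_prior :: "nat \<Rightarrow> (nat \<Rightarrow> real) pmf" where
  "label_prior n = Pi_pmf {..<n} 0 (\<lambda>_. rademacher_pmf)"

definition signal_prior :: "nat \<Rightarrow> nat \<Rightarrow> real \<Rightarrow> (nat \<Rightarrow> real) pmf" where
  "signal_prior p s \<Delta> =
     bind_pmf (pmf_of_set {S. S \<subseteq> {..<p} \<and> card S = s})
       (\<lambda>S. Pi_pmf {..<p} 0
         (\<lambda>j. if j \<in> S then map_pmf (\<lambda>r. \<Delta> / sqrt (real s) * r) rademacher_pmf
              else return_pmf 0))"

(* Law of X_i = z_i \<theta> + \<epsilon>_i with z, \<theta>, \<epsilon> independent; the noise \<epsilon> has the null distribution. *)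
definition planted_dist :: "nat \<Rightarrow> nat \<Rightarrow> nat \<Rightarrow> real \<Rightarrow> (nat \<times> nat \<Rightarrow> real) measure" where
  "planted_dist n p s \<Delta> =
     distr (measure_pmf (pair_pmf (label_prior n) (signal_prior p s \<Delta>)) \<Otimes>\<^sub>M null_dist n p)
       (null_dist n p)
       (\<lambda>((z, \<theta>), \<epsilon>). \<lambda>(i, j)\<in>data_index n p. z i * \<theta> j + \<epsilon> (i, j))"

(* Real polynomial functions of total degree at most D in finitely many variables x k, k \<in> I. *)
definition poly_funs_le :: "'k set \<Rightarrow> nat \<Rightarrow> (('k \<Rightarrow> real) \<Rightarrow> real) set" where
  "poly_funs_le I D =
     {f. \<exists>c. f = (\<lambda>x. \<Sum>\<alpha>\<in>{\<alpha> \<in> I \<rightarrow>\<^sub>E UNIV. (\<Sum>k\<in>I. \<alpha> k) \<le> D}. c \<alpha> * (\<Prod>k\<in>I. x k ^ \<alpha> k))}"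

(* For 1 \<le> s \<le> p the maximum is attained (at the projection of the likelihood ratio), so GREATEST is
   its value. A real polynomial is nonzero iff its polynomial function is. *)
definition low_degree_norm :: "nat \<Rightarrow> nat \<Rightarrow> nat \<Rightarrow> real \<Rightarrow> nat \<Rightarrow> real" where
  "low_degree_norm n p s \<Delta> D =
     (GREATEST r. \<exists>f\<in>poly_funs_le (data_index n p) D. f \<noteq> (\<lambda>_. 0) \<and>
        r = (\<integral>X. f X \<partial>planted_dist n p s \<Delta>) / sqrt (\<integral>X. (f X)\<^sup>2 \<partial>null_dist n p))"

end

theory Submission
  imports Defs
begin

text \<open>
Write \<open>u\<close> for the mean \<open>(z i * \<theta> j)\<close> of the data under the planted law. Conditionally on \<open>u\<close>, the
planted law is a translate of the standard Gaussian, and its likelihood ratio has the Hermite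
expansion \<open>\<Sum>\<alpha>. u^\<alpha> / \<alpha>! * He_\<alpha>\<close>. Truncating this at total degree \<open>D\<close> and averaging over \<open>u\<close> gives a
polynomial \<open>g\<close> of degree at most \<open>D\<close> that represents the planted expectation: for every polynomial \<open>f\<close>
of degree at most \<open>D\<close>, the planted mean of \<open>f\<close> is the null mean of \<open>f * g\<close> (lemma
\<open>integral_poly_funs_translate\<close> for fixed \<open>u\<close>). By the Cauchy-Schwarz inequality the maximal ratio is
attained at \<open>g\<close> and equals its null norm. As \<open>He_\<alpha>\<close> has mean \<open>w^\<alpha>\<close> under the Gaussian centred at \<open>w\<close>,
the multinomial theorem turns the square of that norm into a replica sum over two independent copies
\<open>u\<close>, \<open>u'\<close> (lemma \<open>greatest_ratio_planted_gauss\<close>):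
\<open>\<Sum>d\<le>D. E (u \<bullet> u')^d / d!\<close>, where \<open>u \<bullet> u' = (z \<bullet> z') * (\<theta> \<bullet> \<theta>')\<close>.

Both factors are linear combinations of independent signs once the other copy and the supports are
fixed. The moment generating function \<open>\<Prod>i. cosh (t i * x)\<close> of such a combination is bounded
coefficientwise by \<open>exp (v * x^2 / 2)\<close> with \<open>v = \<Sum>i. (t i)^2\<close>; so odd moments vanish and even moments are
at most Gaussian (lemma \<open>scaled_signs_moment\<close>). For the labels \<open>v = n\<close>. For the signals
\<open>v = \<Delta>^4 / s^2 * H\<close>, where \<open>H\<close> is the size of the intersection of two random \<open>s\<close>-subsets of \<open>p\<close> points,
and \<open>E H^k \<le> (s^2 / p + k)^k\<close> (lemma \<open>overlap_moment\<close>).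

The term of degree \<open>d = 2 * k\<close> is therefore at most
\<open>(2 k choose k) / 4^k * (n * \<Delta>^4 / p + n * \<Delta>^4 * k / s^2)^k \<le> x^k\<close> with
\<open>x = n * \<Delta>^4 / p + n * \<Delta>^4 * D / s^2\<close>, and the sum exceeds 1 by at most \<open>x / (1 - x)\<close>. It is
at least 1, as the constant polynomial shows. The hypothesis on the limit superior eventually keeps
\<open>x\<close> below a constant smaller than 1, because \<open>a + b \<le> (sqrt a + sqrt (4 * b))^2\<close>
for nonnegative \<open>a\<close> and \<open>b\<close>.
\<close>

section \<open>Hermite polynomials and the Gaussian mean\<close>

abbreviation std_gauss :: "real measure" where
  "std_gauss \<equiv> density lborel std_normal_density"

definition gauss_mean :: "real poly \<Rightarrow> real" where
  "gauss_mean q = (\<integral>x. poly q x \<partial>std_gauss)"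

text \<open>
These are the probabilists' Hermite polynomials, normalised to have leading coefficient 1. The
recursion is the one that makes Gaussian integration by parts immediate.
\<close>

fun hermite :: "nat \<Rightarrow> real poly" where
  "hermite 0 = 1"
| "hermite (Suc a) = pCons 0 (hermite a) - pderiv (hermite a)"

lemma prob_space_std_gauss: "prob_space std_gauss"
  by (rule prob_space_normal_density) simp

lemma integrable_power_std_gauss: "integrable std_gauss (\<lambda>x. x ^ k)"
  using integrable_std_normal_moment[of k]
  by (subst integrable_density) auto

lemma integrable_poly_std_gauss: "integrable std_gauss (poly q)"
  unfolding poly_altdef by (intro Bochner_Integration.integrable_sum integrable_mult_right integrable_power_std_gauss)

lemma gauss_mean_add: "gauss_mean (q + r) = gauss_mean q + gauss_mean r"
  unfolding gauss_mean_def poly_add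
  by (rule Bochner_Integration.integral_add) (rule integrable_poly_std_gauss)+

lemma gauss_mean_diff: "gauss_mean (q - r) = gauss_mean q - gauss_mean r"
  unfolding gauss_mean_def poly_diff
  by (rule Bochner_Integration.integral_diff) (rule integrable_poly_std_gauss)+

lemma gauss_mean_smult: "gauss_mean (smult c q) = c * gauss_mean q"
  unfolding gauss_mean_def poly_smult by (rule integral_mult_right_zero)

lemma gauss_mean_sum: "gauss_mean (\<Sum>i\<in>A. q i) = (\<Sum>i\<in>A. gauss_mean (q i))"
  unfolding gauss_mean_def poly_sum
  by (rule Bochner_Integration.integral_sum) (rule integrable_poly_std_gauss)

lemma gauss_mean_one: "gauss_mean 1 = 1"
  using prob_space.prob_space[OF prob_space_std_gauss] by (simp add: gauss_mean_def)

lemma gauss_mean_monom_even: "gauss_mean (monom 1 (2 * k)) = fact (2 * k) / (2 ^ k * fact k)"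
  unfolding gauss_mean_def poly_monom
  using integral_std_normal_moment_even[of k] by (subst integral_density) auto

lemma gauss_mean_monom_odd: "gauss_mean (monom 1 (Suc (2 * k))) = 0"
  unfolding gauss_mean_def poly_monom
  using integral_std_normal_moment_odd[of k] by (subst integral_density) auto

lemma gauss_mean_monom_Suc:
  "gauss_mean (monom 1 (Suc k)) = real k * gauss_mean (monom 1 (k - 1))"
proof (cases "even k")
  case True
  then obtain l where k: "k = 2 * l" by (elim evenE)
  show ?thesis
  proof (cases l)
    case 0
    then show ?thesis using k gauss_mean_monom_odd[of 0] by simp
  next
    case (Suc l')
    then have "k - 1 = Suc (2 * l')" using k by simp
    then show ?thesis using gauss_mean_monom_odd[of l'] gauss_mean_monom_odd[of l] by (simp add: k)
  qed
next
  case False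
  then obtain l where k: "k = Suc (2 * l)" by (metis oddE Suc_eq_plus1)
  have eq: "Suc k = 2 * Suc l" and eq': "k - 1 = 2 * l" using k by simp_all
  have "gauss_mean (monom 1 (Suc k)) = fact (2 * Suc l) / (2 ^ Suc l * fact (Suc l))"
    unfolding eq by (rule gauss_mean_monom_even)
  also have "fact (2 * Suc l) = 2 * real (Suc l) * (real k * fact (2 * l))"
    by (simp add: k algebra_simps)
  also have "\<dots> / (2 ^ Suc l * fact (Suc l)) = real k * (fact (2 * l) / (2 ^ l * fact l))"
    by (simp del: of_nat_Suc)
  finally show ?thesis unfolding eq' gauss_mean_monom_even .
qed

text \<open>
Gaussian integration by parts. By linearity it suffices to check monomials, where it is the recursion
of the Gaussian moments.
\<close>

lemma gauss_mean_stein: "gauss_mean (pCons 0 q) = gauss_mean (pderiv q)"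
proof -
  have monom: "gauss_mean (pCons 0 (monom c i)) = gauss_mean (pderiv (monom c i))" for c :: real and i
  proof -
    have "pCons 0 (monom c i) = smult c (monom 1 (Suc i))"
      by (simp add: monom_Suc smult_monom)
    moreover have "pderiv (monom c i) = smult (c * real i) (monom 1 (i - 1))"
      by (simp add: pderiv_monom smult_monom mult.commute)
    ultimately show ?thesis
      by (simp add: gauss_mean_smult gauss_mean_monom_Suc)
  qed
  define m where "m = (\<lambda>i. monom (coeff q i) i)"
  have q: "q = (\<Sum>i\<le>degree q. m i)" by (simp add: m_def poly_as_sum_of_monoms)
  have "pCons 0 (\<Sum>i\<le>degree q. m i) = (\<Sum>i\<le>degree q. pCons 0 (m i))"
    using sum_distrib_left[of "[:0, 1:]" m "{..degree q}"] by simp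
  moreover have "pderiv (\<Sum>i\<le>n. m i) = (\<Sum>i\<le>n. pderiv (m i))" for n
    by (induction n) (simp_all add: pderiv_add)
  ultimately have "gauss_mean (pCons 0 (\<Sum>i\<le>degree q. m i)) = gauss_mean (pderiv (\<Sum>i\<le>degree q. m i))"
    by (simp add: gauss_mean_sum monom m_def)
  then show ?thesis using q by simp
qed

lemma degree_hermite_le: "degree (hermite a) \<le> a"
proof (induction a)
  case (Suc a)
  have "degree (pCons 0 (hermite a)) \<le> Suc a"
    using Suc degree_pCons_le[of 0 "hermite a"] by linarith
  moreover have "degree (pderiv (hermite a)) \<le> Suc a"
    using Suc by (simp add: degree_pderiv)
  ultimately show ?case by (simp add: degree_diff_le)
qed simp

text \<open>
In the recursion for \<open>hermite (Suc a)\<close>, evaluated at \<open>x + z\<close>, integration by parts cancels the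
contribution of \<open>x\<close> against the derivative and leaves the factor \<open>z\<close>.
\<close>

lemma gauss_mean_hermite_shift: "gauss_mean (hermite a \<circ>\<^sub>p [:z, 1:]) = z ^ a"
proof (induction a)
  case 0
  then show ?case by (simp add: gauss_mean_one pcompose_1)
next
  case (Suc a)
  let ?h = "hermite a \<circ>\<^sub>p [:z, 1:]"
  have "hermite (Suc a) \<circ>\<^sub>p [:z, 1:] = smult z ?h + pCons 0 ?h - pderiv ?h"
    by (simp add: pcompose_diff pcompose_pCons pderiv_pcompose pderiv_pCons algebra_simps)
  then show ?case
    using Suc by (simp add: gauss_mean_diff gauss_mean_add gauss_mean_smult gauss_mean_stein)
qed

text \<open>
Integration by parts produces two derivatives, and the recursion for \<open>hermite (Suc a)\<close> cancels the one
that falls on \<open>hermite a\<close>. Iterated, this trades the Hermite polynomial for derivatives of \<open>q\<close>.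
\<close>

lemma gauss_mean_hermite_mult: "gauss_mean (hermite (Suc a) * q) = gauss_mean (hermite a * pderiv q)"
proof -
  have "hermite (Suc a) * q = pCons 0 (hermite a * q) - pderiv (hermite a) * q"
    by (simp add: algebra_simps)
  then show ?thesis
    by (simp add: gauss_mean_diff gauss_mean_add gauss_mean_stein pderiv_mult algebra_simps)
qed

lemma gauss_mean_hermite_monom:
  "gauss_mean (hermite a * monom 1 b) =
     (if a \<le> b then fact b / fact (b - a) * gauss_mean (monom 1 (b - a)) else 0)"
proof (induction a arbitrary: b)
  case 0
  then show ?case by simp
next
  case (Suc a)
  show ?case
  proof (cases b)
    case 0
    then show ?thesis
      using gauss_mean_hermite_mult[of a "monom 1 0"] by (simp add: pderiv_monom gauss_mean_def)
  next
    case (Suc b')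
    have "hermite a * pderiv (monom 1 b) = smult (real b) (hermite a * monom 1 b')"
      by (simp add: Suc pderiv_monom smult_monom flip: mult_smult_right)
    then have "gauss_mean (hermite (Suc a) * monom 1 b) = real b * gauss_mean (hermite a * monom 1 b')"
      by (simp add: gauss_mean_hermite_mult gauss_mean_smult del: hermite.simps)
    then show ?thesis
      by (simp add: Suc.IH Suc del: hermite.simps)
  qed
qed

text \<open>
This is the Hermite expansion of a translation, that is, Taylor's formula under the integral sign. Any
upper limit \<open>m \<ge> b\<close> is admissible, as the Hermite polynomials of degree above \<open>b\<close> are orthogonal to
\<open>x ^ b\<close>; a common limit for all coordinates is needed to exchange product and sum later.
\<close>

lemma gauss_mean_shift_monom:
  assumes "b \<le> m"
  shows "gauss_mean (monom 1 b \<circ>\<^sub>p [:z, 1:]) =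
    (\<Sum>a\<le>m. z ^ a / fact a * gauss_mean (hermite a * monom 1 b))"
proof -
  have "monom 1 b \<circ>\<^sub>p [:z, 1:] = ([:z:] + [:0, 1:]) ^ b"
    by (simp add: monom_altdef poly_eq_poly_eq_iff[symmetric] poly_pcompose fun_eq_iff)
  also have "\<dots> = (\<Sum>a\<le>b. of_nat (b choose a) * [:z:] ^ a * [:0, 1:] ^ (b - a))"
    by (rule binomial_ring)
  also have "\<dots> = (\<Sum>a\<le>b. smult (real (b choose a) * z ^ a) (monom 1 (b - a)))"
    by (intro sum.cong refl) (simp add: monom_altdef of_nat_poly poly_const_pow mult.commute)
  finally have "gauss_mean (monom 1 b \<circ>\<^sub>p [:z, 1:])
      = (\<Sum>a\<le>b. real (b choose a) * z ^ a * gauss_mean (monom 1 (b - a)))"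
    by (simp add: gauss_mean_sum gauss_mean_smult)
  also have "\<dots> = (\<Sum>a\<le>b. z ^ a / fact a * gauss_mean (hermite a * monom 1 b))"
    by (intro sum.cong refl) (simp add: gauss_mean_hermite_monom binomial_fact)
  also have "\<dots> = (\<Sum>a\<le>m. z ^ a / fact a * gauss_mean (hermite a * monom 1 b))"
    using assms by (intro sum.mono_neutral_left) (auto simp: gauss_mean_hermite_monom)
  finally show ?thesis .
qed

section \<open>Multi-indices and polynomial functions\<close>

definition multi_index :: "'k set \<Rightarrow> nat \<Rightarrow> ('k \<Rightarrow> nat) set" where
  "multi_index I d = {\<alpha> \<in> I \<rightarrow>\<^sub>E UNIV. (\<Sum>k\<in>I. \<alpha> k) \<le> d}"

lemma multi_index_le:
  assumes "finite I" "\<alpha> \<in> multi_index I d" "k \<in> I"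
  shows "\<alpha> k \<le> d"
proof -
  have "\<alpha> k \<le> (\<Sum>k\<in>I. \<alpha> k)" using assms by (intro member_le_sum) auto
  then show ?thesis using assms by (simp add: multi_index_def)
qed

lemma multi_index_subset:
  assumes "finite I" shows "multi_index I d \<subseteq> I \<rightarrow>\<^sub>E {..d}"
  using multi_index_le[OF assms] unfolding multi_index_def PiE_def Pi_def by fastforce

lemma finite_multi_index:
  assumes "finite I" shows "finite (multi_index I d)"
  using multi_index_subset[OF assms] by (rule finite_subset) (intro finite_PiE assms finite_atMost)

lemma poly_funs_le_iff:
  "f \<in> poly_funs_le I D \<longleftrightarrow> (\<exists>c. f = (\<lambda>x. \<Sum>\<alpha>\<in>multi_index I D. c \<alpha> * (\<Prod>k\<in>I. x k ^ \<alpha> k)))"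
  by (simp add: poly_funs_le_def multi_index_def)

text \<open>
The multinomial theorem, divided by \<open>d!\<close>. Induction on \<open>I\<close> splits off the exponent \<open>a\<close> of one variable
and applies the binomial theorem.
\<close>

lemma multinomial_sum_eq:
  fixes u :: "'k \<Rightarrow> real"
  assumes "finite I"
  shows "(\<Sum>\<alpha> | \<alpha> \<in> I \<rightarrow>\<^sub>E UNIV \<and> (\<Sum>k\<in>I. \<alpha> k) = d. \<Prod>k\<in>I. u k ^ \<alpha> k / fact (\<alpha> k)) =
    (\<Sum>k\<in>I. u k) ^ d / fact d"
  using assms
proof (induction I arbitrary: d rule: finite_induct)
  case empty
  have "{\<alpha>. \<alpha> = (\<lambda>x. undefined) \<and> d = 0} = (if d = 0 then {\<lambda>x. undefined} else {})" by auto
  then show ?case by (cases "d = 0") (auto simp: PiE_def)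
next
  case (insert i I)
  let ?M = "\<lambda>I d. {\<alpha>. \<alpha> \<in> I \<rightarrow>\<^sub>E (UNIV :: nat set) \<and> (\<Sum>k\<in>I. \<alpha> k) = d}"
  have upd: "(\<Sum>k\<in>I. (g(i := a)) k) = (\<Sum>k\<in>I. g k)" for g and a :: nat
    using insert.hyps by (intro sum.cong) auto
  have updp: "(\<Prod>k\<in>I. u k ^ (g(i := a)) k / fact ((g(i := a)) k)) = (\<Prod>k\<in>I. u k ^ g k / fact (g k))" for g and a :: nat
    using insert.hyps by (intro prod.cong) auto
  have bij: "bij_betw (\<lambda>(a, g). g(i := a)) (SIGMA a:{..d}. ?M I (d - a)) (?M (insert i I) d)"
  proof (rule bij_betw_imageI)
    show "inj_on (\<lambda>(a, g). g(i := a)) (SIGMA a:{..d}. ?M I (d - a))"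
      by (rule inj_on_subset[OF inj_combinator[OF insert.hyps(2), of "\<lambda>_. UNIV"]]) auto
    show "(\<lambda>(a, g). g(i := a)) ` (SIGMA a:{..d}. ?M I (d - a)) = ?M (insert i I) d"
      (is "?h ` ?A = ?B")
    proof
      show "?h ` ?A \<subseteq> ?B"
        using insert.hyps upd by (auto simp: PiE_insert_eq)
      show "?B \<subseteq> ?h ` ?A"
      proof
        fix \<alpha> assume \<alpha>: "\<alpha> \<in> ?B"
        then have "\<alpha> \<in> (\<lambda>(y, g). g(i := y)) ` (UNIV \<times> (I \<rightarrow>\<^sub>E UNIV))"
          by (simp add: PiE_insert_eq)
        then obtain a g where g: "\<alpha> = g(i := a)" "g \<in> I \<rightarrow>\<^sub>E UNIV" by auto
        then have "a + (\<Sum>k\<in>I. g k) = d" using \<alpha> insert.hyps upd by auto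
        then have "(a, g) \<in> ?A" using g by auto
        then show "\<alpha> \<in> ?h ` ?A" using g by force
      qed
    qed
  qed
  have fin: "finite (?M I e)" for e
    by (rule finite_subset[OF _ finite_multi_index[OF insert.hyps(1), of e]]) (auto simp: multi_index_def)
  have "(\<Sum>\<alpha>\<in>?M (insert i I) d. \<Prod>k\<in>insert i I. u k ^ \<alpha> k / fact (\<alpha> k)) =
      (\<Sum>(a, g)\<in>(SIGMA a:{..d}. ?M I (d - a)). \<Prod>k\<in>insert i I. u k ^ (g(i := a)) k / fact ((g(i := a)) k))"
    by (subst sum.reindex_bij_betw[OF bij, symmetric]) (simp add: case_prod_unfold)
  also have "\<dots> = (\<Sum>(a, g)\<in>(SIGMA a:{..d}. ?M I (d - a)). u i ^ a / fact a * (\<Prod>k\<in>I. u k ^ g k / fact (g k)))"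
    using insert.hyps updp by (intro sum.cong) auto
  also have "\<dots> = (\<Sum>a\<le>d. \<Sum>g\<in>?M I (d - a). u i ^ a / fact a * (\<Prod>k\<in>I. u k ^ g k / fact (g k)))"
    using fin by (subst sum.Sigma) auto
  also have "\<dots> = (\<Sum>a\<le>d. u i ^ a / fact a * ((\<Sum>k\<in>I. u k) ^ (d - a) / fact (d - a)))"
    by (simp only: insert.IH flip: sum_distrib_left)
  also have "\<dots> = (u i + (\<Sum>k\<in>I. u k)) ^ d / fact d"
    unfolding binomial_ring sum_divide_distrib
    by (intro sum.cong refl) (simp add: binomial_fact field_simps)
  finally show ?case using insert.hyps by simp
qed

lemma multinomial_sum_le:
  fixes u :: "'k \<Rightarrow> real"
  assumes "finite I"
  shows "(\<Sum>\<alpha>\<in>multi_index I D. \<Prod>k\<in>I. u k ^ \<alpha> k / fact (\<alpha> k)) = (\<Sum>d\<le>D. (\<Sum>k\<in>I. u k) ^ d / fact d)"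
proof -
  have "(\<Sum>\<alpha>\<in>multi_index I D. \<Prod>k\<in>I. u k ^ \<alpha> k / fact (\<alpha> k)) =
     (\<Sum>d\<le>D. \<Sum>\<alpha> | \<alpha> \<in> multi_index I D \<and> (\<Sum>k\<in>I. \<alpha> k) = d. \<Prod>k\<in>I. u k ^ \<alpha> k / fact (\<alpha> k))"
    by (intro sum.group[symmetric] finite_multi_index assms) (auto simp: multi_index_def)
  also have "\<dots> = (\<Sum>d\<le>D. \<Sum>\<alpha> | \<alpha> \<in> I \<rightarrow>\<^sub>E UNIV \<and> (\<Sum>k\<in>I. \<alpha> k) = d. \<Prod>k\<in>I. u k ^ \<alpha> k / fact (\<alpha> k))"
    by (intro sum.cong refl) (auto simp: multi_index_def)
  finally show ?thesis by (simp add: multinomial_sum_eq assms)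
qed

lemma poly_funs_le_cmult: "f \<in> poly_funs_le I D \<Longrightarrow> (\<lambda>x. r * f x) \<in> poly_funs_le I D"
proof -
  assume "f \<in> poly_funs_le I D"
  then obtain c where f: "f = (\<lambda>x. \<Sum>\<alpha>\<in>multi_index I D. c \<alpha> * (\<Prod>k\<in>I. x k ^ \<alpha> k))"
    unfolding poly_funs_le_iff by blast
  show ?thesis
    unfolding poly_funs_le_iff
    by (rule exI[of _ "\<lambda>\<alpha>. r * c \<alpha>"]) (simp add: f sum_distrib_left mult.assoc)
qed

lemma poly_funs_le_sum:
  assumes "\<And>a. a \<in> A \<Longrightarrow> F a \<in> poly_funs_le I D"
  shows "(\<lambda>x. \<Sum>a\<in>A. F a x) \<in> poly_funs_le I D"
proof -
  have "\<forall>a\<in>A. \<exists>c. F a = (\<lambda>x. \<Sum>\<alpha>\<in>multi_index I D. c \<alpha> * (\<Prod>k\<in>I. x k ^ \<alpha> k))"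
    using assms unfolding poly_funs_le_iff by blast
  then obtain c where c: "\<forall>a\<in>A. F a = (\<lambda>x. \<Sum>\<alpha>\<in>multi_index I D. c a \<alpha> * (\<Prod>k\<in>I. x k ^ \<alpha> k))"
    by (metis (no_types))
  have "(\<lambda>x. \<Sum>a\<in>A. F a x) = (\<lambda>x. \<Sum>\<alpha>\<in>multi_index I D. (\<Sum>a\<in>A. c a \<alpha>) * (\<Prod>k\<in>I. x k ^ \<alpha> k))"
    using c by (simp add: sum_distrib_right sum.swap[of _ _ A])
  then show ?thesis
    unfolding poly_funs_le_iff by (rule exI[of _ "\<lambda>\<alpha>. \<Sum>a\<in>A. c a \<alpha>"])
qed

lemma poly_eq_sum_atMost:
  fixes q :: "real poly"
  assumes "degree q \<le> n"
  shows "poly q y = (\<Sum>i\<le>n. coeff q i * y ^ i)"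
  unfolding poly_altdef using assms
  by (intro sum.mono_neutral_left) (auto simp: coeff_eq_0)

text \<open>
Expanding the product only produces exponents that are coordinatewise at most \<open>\<alpha>\<close>.
\<close>

lemma prod_poly_in_poly_funs_le:
  assumes "finite I" "\<alpha> \<in> multi_index I D" "\<And>k. k \<in> I \<Longrightarrow> degree (q k) \<le> \<alpha> k"
  shows "(\<lambda>x. \<Prod>k\<in>I. poly (q k) (x k)) \<in> poly_funs_le I D"
proof -
  let ?B = "PiE I (\<lambda>k. {..\<alpha> k})"
  have sub: "?B \<subseteq> multi_index I D"
  proof
    fix \<beta> assume \<beta>: "\<beta> \<in> ?B"
    have "(\<Sum>k\<in>I. \<beta> k) \<le> (\<Sum>k\<in>I. \<alpha> k)" using \<beta> by (intro sum_mono) auto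
    also have "\<dots> \<le> D" using assms by (simp add: multi_index_def)
    finally show "\<beta> \<in> multi_index I D" using \<beta> by (auto simp: multi_index_def PiE_def)
  qed
  define c where "c = (\<lambda>\<beta>. if \<beta> \<in> ?B then \<Prod>k\<in>I. coeff (q k) (\<beta> k) else 0)"
  have "(\<Prod>k\<in>I. poly (q k) (x k)) = (\<Sum>\<beta>\<in>multi_index I D. c \<beta> * (\<Prod>k\<in>I. x k ^ \<beta> k))" for x
  proof -
    have "(\<Prod>k\<in>I. poly (q k) (x k)) = (\<Prod>k\<in>I. \<Sum>i\<le>\<alpha> k. coeff (q k) i * x k ^ i)"
      by (intro prod.cong refl poly_eq_sum_atMost) (use assms in auto)
    also have "\<dots> = (\<Sum>\<beta>\<in>?B. \<Prod>k\<in>I. coeff (q k) (\<beta> k) * x k ^ \<beta> k)"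
      by (intro prod_sum_PiE assms) auto
    also have "\<dots> = (\<Sum>\<beta>\<in>?B. c \<beta> * (\<Prod>k\<in>I. x k ^ \<beta> k))"
      by (intro sum.cong refl) (simp add: c_def prod.distrib)
    also have "\<dots> = (\<Sum>\<beta>\<in>multi_index I D. c \<beta> * (\<Prod>k\<in>I. x k ^ \<beta> k))"
      by (intro sum.mono_neutral_left finite_multi_index assms sub) (auto simp: c_def)
    finally show ?thesis .
  qed
  then show ?thesis unfolding poly_funs_le_iff by blast
qed

section \<open>Low-degree projection of a Gaussian likelihood ratio\<close>

abbreviation gauss_product :: "'k set \<Rightarrow> ('k \<Rightarrow> real) measure" where
  "gauss_product I \<equiv> Pi\<^sub>M I (\<lambda>_. std_gauss)"

lemma product_sigma_finite_std_gauss: "product_sigma_finite (\<lambda>_. std_gauss)"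
  by (intro product_sigma_finite.intro prob_space_imp_sigma_finite prob_space_std_gauss)

lemma prob_space_gauss_product: "prob_space (gauss_product I)"
  by (intro prob_space_PiM prob_space_std_gauss)

lemma integrable_prod_poly:
  "finite I \<Longrightarrow> integrable (gauss_product I) (\<lambda>x. \<Prod>k\<in>I. poly (q k) (x k))"
  by (rule product_sigma_finite.product_integrable_prod[OF product_sigma_finite_std_gauss])
     (auto intro: integrable_poly_std_gauss)

lemma integral_prod_poly:
  "finite I \<Longrightarrow> (\<integral>x. (\<Prod>k\<in>I. poly (q k) (x k)) \<partial>gauss_product I) = (\<Prod>k\<in>I. gauss_mean (q k))"
  unfolding gauss_mean_def
  by (rule product_sigma_finite.product_integral_prod[OF product_sigma_finite_std_gauss])
     (auto intro: integrable_poly_std_gauss)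

lemma integrable_poly_funs_mult:
  assumes I: "finite I" and f: "f \<in> poly_funs_le I D" and g: "g \<in> poly_funs_le I D'"
  shows "integrable (gauss_product I) (\<lambda>x. f x * g x)"
proof -
  obtain c where f: "f = (\<lambda>x. \<Sum>\<alpha>\<in>multi_index I D. c \<alpha> * (\<Prod>k\<in>I. x k ^ \<alpha> k))"
    using f unfolding poly_funs_le_iff by blast
  obtain d where g: "g = (\<lambda>x. \<Sum>\<alpha>\<in>multi_index I D'. d \<alpha> * (\<Prod>k\<in>I. x k ^ \<alpha> k))"
    using g unfolding poly_funs_le_iff by blast
  have "integrable (gauss_product I)
     (\<lambda>x. \<Sum>\<alpha>\<in>multi_index I D. \<Sum>\<beta>\<in>multi_index I D'.
        c \<alpha> * d \<beta> * (\<Prod>k\<in>I. poly (monom 1 (\<alpha> k + \<beta> k)) (x k)))"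
    by (intro Bochner_Integration.integrable_sum integrable_mult_right integrable_prod_poly I)
  also have "(\<lambda>x. \<Sum>\<alpha>\<in>multi_index I D. \<Sum>\<beta>\<in>multi_index I D'.
        c \<alpha> * d \<beta> * (\<Prod>k\<in>I. poly (monom 1 (\<alpha> k + \<beta> k)) (x k))) = (\<lambda>x. f x * g x)"
    by (simp add: f g sum_product poly_monom power_add prod.distrib mult_ac)
  finally show ?thesis .
qed

lemma one_in_poly_funs_le:
  assumes "finite I" shows "(\<lambda>_. 1) \<in> poly_funs_le I D"
proof -
  have "(\<lambda>x. \<Prod>k\<in>I. poly ((\<lambda>_. 1) k) (x k)) \<in> poly_funs_le I D"
    by (rule prod_poly_in_poly_funs_le[of _ "restrict (\<lambda>_. 0) I"]) (auto simp: assms multi_index_def)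
  then show ?thesis by simp
qed

lemma integrable_poly_funs:
  assumes "finite I" "f \<in> poly_funs_le I D"
  shows "integrable (gauss_product I) f"
  using integrable_poly_funs_mult[OF assms one_in_poly_funs_le[OF assms(1), of 0]] by simp

definition translate :: "'k set \<Rightarrow> ('k \<Rightarrow> real) \<Rightarrow> ('k \<Rightarrow> real) \<Rightarrow> 'k \<Rightarrow> real" where
  "translate I v x = (\<lambda>k\<in>I. v k + x k)"

text \<open>
This is the projection, onto degree at most \<open>D\<close>, of the likelihood ratio
\<open>exp (\<Sum>k\<in>I. v k * x k - (v k)^2 / 2)\<close> of the Gaussian centred at \<open>v\<close> against the centred one.
\<close>

definition trunc_ratio :: "'k set \<Rightarrow> nat \<Rightarrow> ('k \<Rightarrow> real) \<Rightarrow> ('k \<Rightarrow> real) \<Rightarrow> real" where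
  "trunc_ratio I D v x =
     (\<Sum>\<alpha>\<in>multi_index I D. (\<Prod>k\<in>I. v k ^ \<alpha> k / fact (\<alpha> k)) * (\<Prod>k\<in>I. poly (hermite (\<alpha> k)) (x k)))"

lemma prod_hermite_in_poly_funs_le:
  assumes "finite I" "\<alpha> \<in> multi_index I D"
  shows "(\<lambda>x. \<Prod>k\<in>I. poly (hermite (\<alpha> k)) (x k)) \<in> poly_funs_le I D"
  using assms by (rule prod_poly_in_poly_funs_le) (rule degree_hermite_le)

lemma trunc_ratio_in_poly_funs_le:
  assumes "finite I" shows "trunc_ratio I D v \<in> poly_funs_le I D"
  unfolding trunc_ratio_def[abs_def]
  by (intro poly_funs_le_sum poly_funs_le_cmult prod_hermite_in_poly_funs_le assms)

lemma integral_prod_poly_translate: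
  assumes "finite I"
  shows "integrable (gauss_product I) (\<lambda>x. \<Prod>k\<in>I. poly (q k) (translate I v x k))"
    and "(\<integral>x. (\<Prod>k\<in>I. poly (q k) (translate I v x k)) \<partial>gauss_product I) =
      (\<Prod>k\<in>I. gauss_mean (q k \<circ>\<^sub>p [:v k, 1:]))"
proof -
  have eq: "(\<Prod>k\<in>I. poly (q k) (translate I v x k)) = (\<Prod>k\<in>I. poly (q k \<circ>\<^sub>p [:v k, 1:]) (x k))" for x
    by (intro prod.cong refl) (simp add: translate_def poly_pcompose)
  show "integrable (gauss_product I) (\<lambda>x. \<Prod>k\<in>I. poly (q k) (translate I v x k))"
    unfolding eq by (intro integrable_prod_poly assms)
  show "(\<integral>x. (\<Prod>k\<in>I. poly (q k) (translate I v x k)) \<partial>gauss_product I) =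
      (\<Prod>k\<in>I. gauss_mean (q k \<circ>\<^sub>p [:v k, 1:]))"
    unfolding eq by (intro integral_prod_poly assms)
qed

lemma integrable_poly_funs_translate:
  assumes "finite I" "f \<in> poly_funs_le I D"
  shows "integrable (gauss_product I) (\<lambda>x. f (translate I v x))"
proof -
  obtain c where f: "f = (\<lambda>x. \<Sum>\<alpha>\<in>multi_index I D. c \<alpha> * (\<Prod>k\<in>I. x k ^ \<alpha> k))"
    using assms unfolding poly_funs_le_iff by blast
  show ?thesis
    unfolding f using integral_prod_poly_translate(1)[OF assms(1), of "\<lambda>k. monom 1 (_ k)" v]
    by (intro Bochner_Integration.integrable_sum integrable_mult_right) (simp add: poly_monom)
qed

text \<open>
Coordinatewise Taylor expansion yields a sum over the box of all exponents up to \<open>D\<close>, which is larger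
than the set of multi-indices of total degree at most \<open>D\<close>. The surplus terms vanish: such an exponent
exceeds \<open>\<beta>\<close> in some coordinate, and there the Hermite polynomial is orthogonal to the monomial.
\<close>

lemma integral_monomial_translate:
  assumes I: "finite I" and \<beta>: "\<beta> \<in> multi_index I D"
  shows "(\<integral>x. (\<Prod>k\<in>I. translate I v x k ^ \<beta> k) \<partial>gauss_product I) =
    (\<integral>x. (\<Prod>k\<in>I. x k ^ \<beta> k) * trunc_ratio I D v x \<partial>gauss_product I)"
proof -
  let ?t = "\<lambda>k a. v k ^ a / fact a * gauss_mean (hermite a * monom 1 (\<beta> k))"
  have "(\<integral>x. (\<Prod>k\<in>I. translate I v x k ^ \<beta> k) \<partial>gauss_product I) =
      (\<Prod>k\<in>I. gauss_mean (monom 1 (\<beta> k) \<circ>\<^sub>p [:v k, 1:]))"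
    using integral_prod_poly_translate(2)[OF I, of "\<lambda>k. monom 1 (\<beta> k)" v] by (simp add: poly_monom)
  also have "\<dots> = (\<Prod>k\<in>I. \<Sum>a\<le>D. ?t k a)"
    using multi_index_le[OF I \<beta>] by (intro prod.cong refl gauss_mean_shift_monom)
  also have "\<dots> = (\<Sum>\<alpha>\<in>I \<rightarrow>\<^sub>E {..D}. \<Prod>k\<in>I. ?t k (\<alpha> k))"
    by (intro prod_sum_PiE I) auto
  also have "\<dots> = (\<Sum>\<alpha>\<in>multi_index I D. \<Prod>k\<in>I. ?t k (\<alpha> k))"
  proof (intro sum.mono_neutral_right multi_index_subset I ballI)
    show "finite (I \<rightarrow>\<^sub>E {..D})" using I by (intro finite_PiE) auto
    fix \<alpha> assume \<alpha>: "\<alpha> \<in> (I \<rightarrow>\<^sub>E {..D}) - multi_index I D"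
    have "\<exists>k\<in>I. \<beta> k < \<alpha> k"
    proof (rule ccontr)
      assume "\<not> (\<exists>k\<in>I. \<beta> k < \<alpha> k)"
      then have "(\<Sum>k\<in>I. \<alpha> k) \<le> (\<Sum>k\<in>I. \<beta> k)" by (intro sum_mono) auto
      then show False using \<alpha> \<beta> by (auto simp: multi_index_def PiE_def)
    qed
    then obtain k where "k \<in> I" "\<not> \<alpha> k \<le> \<beta> k" by auto
    then show "(\<Prod>k\<in>I. ?t k (\<alpha> k)) = 0"
      using I by (intro prod_zero bexI[of _ k]) (auto simp: gauss_mean_hermite_monom)
  qed
  also have "\<dots> = (\<Sum>\<alpha>\<in>multi_index I D. (\<Prod>k\<in>I. v k ^ \<alpha> k / fact (\<alpha> k)) *
      (\<integral>x. (\<Prod>k\<in>I. poly (hermite (\<alpha> k) * monom 1 (\<beta> k)) (x k)) \<partial>gauss_product I))"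
    by (simp only: integral_prod_poly[OF I] prod.distrib)
  also have "\<dots> = (\<integral>x. (\<Sum>\<alpha>\<in>multi_index I D. (\<Prod>k\<in>I. v k ^ \<alpha> k / fact (\<alpha> k)) *
      (\<Prod>k\<in>I. poly (hermite (\<alpha> k) * monom 1 (\<beta> k)) (x k))) \<partial>gauss_product I)"
    using integrable_prod_poly[OF I]
    by (subst Bochner_Integration.integral_sum) (auto simp del: poly_mult)
  also have "\<dots> = (\<integral>x. (\<Prod>k\<in>I. x k ^ \<beta> k) * trunc_ratio I D v x \<partial>gauss_product I)"
    by (simp add: trunc_ratio_def sum_distrib_left poly_monom prod.distrib mult_ac)
  finally show ?thesis .
qed

lemma monomial_in_poly_funs_le:
  assumes "finite I" "\<alpha> \<in> multi_index I D"
  shows "(\<lambda>x. \<Prod>k\<in>I. x k ^ \<alpha> k) \<in> poly_funs_le I D"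
  using prod_poly_in_poly_funs_le[OF assms, of "\<lambda>k. monom 1 (\<alpha> k)"]
  by (simp add: poly_monom degree_monom_le)

lemma integral_poly_funs_translate:
  assumes I: "finite I" and f: "f \<in> poly_funs_le I D"
  shows "(\<integral>x. f (translate I v x) \<partial>gauss_product I) = (\<integral>x. f x * trunc_ratio I D v x \<partial>gauss_product I)"
proof -
  obtain c where f: "f = (\<lambda>x. \<Sum>\<alpha>\<in>multi_index I D. c \<alpha> * (\<Prod>k\<in>I. x k ^ \<alpha> k))"
    using f unfolding poly_funs_le_iff by blast
  have "(\<integral>x. f (translate I v x) \<partial>gauss_product I) =
     (\<Sum>\<alpha>\<in>multi_index I D. c \<alpha> * (\<integral>x. (\<Prod>k\<in>I. translate I v x k ^ \<alpha> k) \<partial>gauss_product I))"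
    unfolding f using integrable_poly_funs_translate[OF I monomial_in_poly_funs_le[OF I]]
    by (subst Bochner_Integration.integral_sum) auto
  also have "\<dots> = (\<Sum>\<alpha>\<in>multi_index I D. c \<alpha> * (\<integral>x. (\<Prod>k\<in>I. x k ^ \<alpha> k) * trunc_ratio I D v x \<partial>gauss_product I))"
    using integral_monomial_translate[OF I] by (intro sum.cong) auto
  also have "\<dots> = (\<integral>x. (\<Sum>\<alpha>\<in>multi_index I D. c \<alpha> * ((\<Prod>k\<in>I. x k ^ \<alpha> k) * trunc_ratio I D v x)) \<partial>gauss_product I)"
    using integrable_poly_funs_mult[OF I monomial_in_poly_funs_le[OF I] trunc_ratio_in_poly_funs_le[OF I]]
    by (subst Bochner_Integration.integral_sum) auto
  also have "\<dots> = (\<integral>x. f x * trunc_ratio I D v x \<partial>gauss_product I)"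
    by (simp add: f sum_distrib_right mult.assoc)
  finally show ?thesis .
qed

text \<open>
Each Hermite product has mean \<open>w ^ \<alpha>\<close> after translation by \<open>w\<close>; the sum over \<open>\<alpha>\<close> is then multinomial.
\<close>

lemma integral_trunc_ratio_translate:
  assumes I: "finite I"
  shows "(\<integral>x. trunc_ratio I D v (translate I w x) \<partial>gauss_product I) = (\<Sum>d\<le>D. (\<Sum>k\<in>I. v k * w k) ^ d / fact d)"
proof -
  have "(\<integral>x. trunc_ratio I D v (translate I w x) \<partial>gauss_product I) =
     (\<Sum>\<alpha>\<in>multi_index I D. (\<Prod>k\<in>I. v k ^ \<alpha> k / fact (\<alpha> k)) *
       (\<integral>x. (\<Prod>k\<in>I. poly (hermite (\<alpha> k)) (translate I w x k)) \<partial>gauss_product I))"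
    unfolding trunc_ratio_def using integral_prod_poly_translate(1)[OF I]
    by (subst Bochner_Integration.integral_sum) auto
  also have "\<dots> = (\<Sum>\<alpha>\<in>multi_index I D. (\<Prod>k\<in>I. v k ^ \<alpha> k / fact (\<alpha> k)) * (\<Prod>k\<in>I. w k ^ \<alpha> k))"
    by (simp only: integral_prod_poly_translate(2)[OF I] gauss_mean_hermite_shift)
  also have "\<dots> = (\<Sum>\<alpha>\<in>multi_index I D. \<Prod>k\<in>I. (v k * w k) ^ \<alpha> k / fact (\<alpha> k))"
    by (simp add: power_mult_distrib flip: prod.distrib)
  also have "\<dots> = (\<Sum>d\<le>D. (\<Sum>k\<in>I. v k * w k) ^ d / fact d)"
    by (rule multinomial_sum_le[OF I])
  finally show ?thesis .
qed

lemma integral_mult_cauchy_schwarz: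
  fixes f g :: "'a \<Rightarrow> real"
  assumes ff: "integrable M (\<lambda>x. f x * f x)" and gg: "integrable M (\<lambda>x. g x * g x)"
    and fg: "integrable M (\<lambda>x. f x * g x)" and pos: "(\<integral>x. g x * g x \<partial>M) > 0"
  shows "(\<integral>x. f x * g x \<partial>M)\<^sup>2 \<le> (\<integral>x. f x * f x \<partial>M) * (\<integral>x. g x * g x \<partial>M)"
proof -
  let ?A = "\<integral>x. f x * g x \<partial>M" and ?B = "\<integral>x. g x * g x \<partial>M" and ?F = "\<integral>x. f x * f x \<partial>M"
  \<comment> \<open>Up to the factor \<open>?B\<close>, this is \<open>f\<close> minus its orthogonal projection onto \<open>g\<close>.\<close>
  have "0 \<le> (\<integral>x. (?B * f x - ?A * g x)\<^sup>2 \<partial>M)" by simp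
  also have "(\<lambda>x. (?B * f x - ?A * g x)\<^sup>2) =
      (\<lambda>x. ?B\<^sup>2 * (f x * f x) - 2 * ?A * ?B * (f x * g x) + ?A\<^sup>2 * (g x * g x))"
    by (simp add: power2_eq_square algebra_simps)
  also have "(\<integral>x. \<dots> x \<partial>M) = ?B\<^sup>2 * ?F - 2 * ?A * ?B * ?A + ?A\<^sup>2 * ?B"
    using ff gg fg by simp
  also have "\<dots> = ?B * (?F * ?B - ?A\<^sup>2)"
    by (simp add: power2_eq_square algebra_simps)
  finally show ?thesis using pos by (simp add: zero_le_mult_iff)
qed

text \<open>
The law of \<open>v \<omega> + x\<close> with \<open>\<omega>\<close> drawn from a discrete prior and \<open>x\<close> standard Gaussian.
\<close>

definition planted_gauss :: "'k set \<Rightarrow> 'w pmf \<Rightarrow> ('w \<Rightarrow> 'k \<Rightarrow> real) \<Rightarrow> ('k \<Rightarrow> real) measure" where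
  "planted_gauss I \<mu> v = distr (measure_pmf \<mu> \<Otimes>\<^sub>M gauss_product I) (gauss_product I)
     (\<lambda>(\<omega>, x). translate I (v \<omega>) x)"

lemma measurable_translate:
  "(\<lambda>(\<omega>, x). translate I (v \<omega>) x) \<in> measure_pmf \<mu> \<Otimes>\<^sub>M gauss_product I \<rightarrow>\<^sub>M gauss_product I"
proof -
  have "(\<lambda>\<omega>x. v (fst \<omega>x) k + snd \<omega>x k) \<in> borel_measurable (measure_pmf \<mu> \<Otimes>\<^sub>M gauss_product I)" if k: "k \<in> I" for k
  proof (rule borel_measurable_add)
    have "(\<lambda>\<omega>. v \<omega> k) \<in> borel_measurable (measure_pmf \<mu>)" by simp
    from measurable_compose[OF measurable_fst this]
    show "(\<lambda>\<omega>x. v (fst \<omega>x) k) \<in> borel_measurable (measure_pmf \<mu> \<Otimes>\<^sub>M gauss_product I)" .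
    have "(\<lambda>x. x k) \<in> gauss_product I \<rightarrow>\<^sub>M std_gauss"
      using k by (rule measurable_component_singleton)
    then have "(\<lambda>x. x k) \<in> borel_measurable (gauss_product I)" by simp
    from measurable_compose[OF measurable_snd this]
    show "(\<lambda>\<omega>x. snd \<omega>x k) \<in> borel_measurable (measure_pmf \<mu> \<Otimes>\<^sub>M gauss_product I)" .
  qed
  then show ?thesis
    unfolding translate_def case_prod_unfold by (intro measurable_restrict) simp
qed

lemma integral_planted_gauss:
  fixes f :: "('k \<Rightarrow> real) \<Rightarrow> real"
  assumes I: "finite I" and \<mu>: "finite (set_pmf \<mu>)" and f: "f \<in> poly_funs_le I D"
  shows "(\<integral>x. f x \<partial>planted_gauss I \<mu> v) =
    measure_pmf.expectation \<mu> (\<lambda>\<omega>. \<integral>x. f (translate I (v \<omega>) x) \<partial>gauss_product I)"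
proof -
  interpret N: prob_space "gauss_product I" by (rule prob_space_gauss_product)
  interpret pair_sigma_finite "measure_pmf \<mu>" "gauss_product I" ..
  have fm: "f \<in> borel_measurable (gauss_product I)"
    using integrable_poly_funs[OF I f] by blast
  have "(\<lambda>y. f ((\<lambda>(\<omega>, x). translate I (v \<omega>) x) y)) \<in> borel_measurable (measure_pmf \<mu> \<Otimes>\<^sub>M gauss_product I)"
    by (rule measurable_compose[OF measurable_translate fm])
  then have meas: "(\<lambda>(\<omega>, x). f (translate I (v \<omega>) x)) \<in> borel_measurable (measure_pmf \<mu> \<Otimes>\<^sub>M gauss_product I)"
    by (simp add: case_prod_unfold)
  have int: "integrable (measure_pmf \<mu> \<Otimes>\<^sub>M gauss_product I) (\<lambda>(\<omega>, x). f (translate I (v \<omega>) x))"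
    using meas
    by (rule Fubini_integrable)
       (auto intro!: integrable_measure_pmf_finite[OF \<mu>] AE_I2 integrable_poly_funs_translate[OF I f])
  have "(\<integral>x. f x \<partial>planted_gauss I \<mu> v) = (\<integral>(\<omega>, x). f (translate I (v \<omega>) x) \<partial>(measure_pmf \<mu> \<Otimes>\<^sub>M gauss_product I))"
    unfolding planted_gauss_def
    by (subst integral_distr[OF measurable_translate fm]) (simp add: case_prod_unfold)
  also have "\<dots> = measure_pmf.expectation \<mu> (\<lambda>\<omega>. \<integral>x. f (translate I (v \<omega>) x) \<partial>gauss_product I)"
    using integral_fst[OF int] by simp
  finally show ?thesis .
qed

text \<open>
The two nested expectations are over independent copies of the same random vector, so this is the
\<open>d\<close>-th Taylor coefficient of the moment generating function of their inner product.
\<close>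

definition replica_moment :: "'k set \<Rightarrow> ('k \<Rightarrow> real) pmf \<Rightarrow> nat \<Rightarrow> real" where
  "replica_moment I \<nu> d = measure_pmf.expectation \<nu> (\<lambda>u. measure_pmf.expectation \<nu>
     (\<lambda>w. (\<Sum>k\<in>I. u k * w k) ^ d)) / fact d"

text \<open>
The averaged truncated ratio \<open>g\<close> represents the planted expectation on polynomials of degree at most
\<open>D\<close>, so Cauchy-Schwarz bounds every ratio by the norm of \<open>g\<close>, and \<open>f = g\<close> attains it. The lower bound
\<open>N2 \<ge> 1\<close> comes from the constant function 1, whose ratio is 1; it also shows \<open>g \<noteq> 0\<close>. If the second
moment of \<open>f\<close> vanishes, its ratio is \<open>0\<close> by the convention for division by zero.
\<close>

lemma greatest_ratio_planted_gauss:
  fixes v :: "'w \<Rightarrow> 'k \<Rightarrow> real" and D :: nat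
  assumes I: "finite I" and \<mu>: "finite (set_pmf \<mu>)"
  defines "N2 \<equiv> \<Sum>d\<le>D. replica_moment I (map_pmf v \<mu>) d"
  shows "(GREATEST r. \<exists>f\<in>poly_funs_le I D. f \<noteq> (\<lambda>_. 0) \<and>
        r = (\<integral>X. f X \<partial>planted_gauss I \<mu> v) / sqrt (\<integral>X. (f X)\<^sup>2 \<partial>gauss_product I)) = sqrt N2"
    and "N2 \<ge> 1"
proof -
  let ?N = "gauss_product I" and ?P = "planted_gauss I \<mu> v" and ?V = "poly_funs_le I D"
  let ?S = "set_pmf \<mu>"
  have exp_sum: "measure_pmf.expectation \<mu> h = (\<Sum>\<omega>\<in>?S. pmf \<mu> \<omega> * h \<omega>)" for h :: "'w \<Rightarrow> real"
    using integral_measure_pmf_real[OF \<mu>, of \<mu> h] by (simp add: mult.commute)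
  \<comment> \<open>The projected likelihood ratio: the average of the truncated ratios over the prior.\<close>
  define g where "g = (\<lambda>x. \<Sum>\<omega>\<in>?S. pmf \<mu> \<omega> * trunc_ratio I D (v \<omega>) x)"
  have g: "g \<in> ?V"
    unfolding g_def by (intro poly_funs_le_sum poly_funs_le_cmult trunc_ratio_in_poly_funs_le I)
  have planted: "(\<integral>x. f x \<partial>?P) = (\<integral>x. f x * g x \<partial>?N)" if f: "f \<in> ?V" for f
  proof -
    have "(\<integral>x. f x \<partial>?P) = (\<Sum>\<omega>\<in>?S. pmf \<mu> \<omega> * (\<integral>x. f x * trunc_ratio I D (v \<omega>) x \<partial>?N))"
      by (simp only: integral_planted_gauss[OF I \<mu> f] exp_sum integral_poly_funs_translate[OF I f])
    also have "\<dots> = (\<integral>x. (\<Sum>\<omega>\<in>?S. pmf \<mu> \<omega> * (f x * trunc_ratio I D (v \<omega>) x)) \<partial>?N)"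
      using integrable_poly_funs_mult[OF I f trunc_ratio_in_poly_funs_le[OF I]]
      by (subst Bochner_Integration.integral_sum) auto
    also have "\<dots> = (\<integral>x. f x * g x \<partial>?N)"
      by (simp add: g_def sum_distrib_left mult_ac)
    finally show ?thesis .
  qed
  have "(\<integral>x. g (translate I w x) \<partial>?N) =
      (\<Sum>\<omega>\<in>?S. pmf \<mu> \<omega> * (\<integral>x. trunc_ratio I D (v \<omega>) (translate I w x) \<partial>?N))" for w
    unfolding g_def using integrable_poly_funs_translate[OF I trunc_ratio_in_poly_funs_le[OF I]]
    by (subst Bochner_Integration.integral_sum) auto
  then have "(\<integral>x. g x \<partial>?P) = measure_pmf.expectation \<mu> (\<lambda>\<omega>'. \<Sum>\<omega>\<in>?S. pmf \<mu> \<omega> *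
      (\<integral>x. trunc_ratio I D (v \<omega>) (translate I (v \<omega>') x) \<partial>?N))"
    by (simp add: integral_planted_gauss[OF I \<mu> g])
  also have "\<dots> = measure_pmf.expectation \<mu> (\<lambda>\<omega>'. measure_pmf.expectation \<mu>
      (\<lambda>\<omega>. \<Sum>d\<le>D. (\<Sum>k\<in>I. v \<omega>' k * v \<omega> k) ^ d / fact d))"
    by (simp only: integral_trunc_ratio_translate[OF I] exp_sum[symmetric] mult.commute)
  also have "\<dots> = N2"
    unfolding N2_def replica_moment_def integral_map_pmf
    by (simp add: Bochner_Integration.integral_sum integrable_measure_pmf_finite[OF \<mu>])
  finally have gP: "(\<integral>x. g x \<partial>?P) = N2" .
  then have gg: "(\<integral>x. g x * g x \<partial>?N) = N2" using planted[OF g] by simp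
  have one: "(\<lambda>_. 1) \<in> ?V" by (rule one_in_poly_funs_le[OF I])
  have N1: "(\<integral>x. 1 \<partial>?N) = (1 :: real)"
    using prob_space.prob_space[OF prob_space_gauss_product, of I] by simp
  have P1: "(\<integral>x. 1 \<partial>?P) = (1 :: real)"
    unfolding integral_planted_gauss[OF I \<mu> one] N1 by simp
  have int: "integrable ?N (\<lambda>x. f x * h x)" if "f \<in> ?V" "h \<in> ?V" for f h
    using integrable_poly_funs_mult[OF I that] .
  have "(\<integral>x. g x * 1 \<partial>?N)\<^sup>2 \<le> (\<integral>x. g x * g x \<partial>?N) * (\<integral>x. 1 * 1 \<partial>?N)"
    using int[OF g g] int[OF one one] int[OF g one] N1 by (intro integral_mult_cauchy_schwarz) simp_all
  moreover have "(\<integral>x. g x * 1 \<partial>?N) = 1" using planted[OF one] P1 by simp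
  ultimately show N2: "N2 \<ge> 1" using N1 gg by simp
  show "(GREATEST r. \<exists>f\<in>?V. f \<noteq> (\<lambda>_. 0) \<and> r = (\<integral>X. f X \<partial>?P) / sqrt (\<integral>X. (f X)\<^sup>2 \<partial>?N)) = sqrt N2"
  proof (rule Greatest_equality)
    have "g \<noteq> (\<lambda>_. 0)" using gg N2 by auto
    moreover have "sqrt N2 = (\<integral>X. g X \<partial>?P) / sqrt (\<integral>X. (g X)\<^sup>2 \<partial>?N)"
      using N2 by (simp add: gP power2_eq_square gg real_div_sqrt)
    ultimately show "\<exists>f\<in>?V. f \<noteq> (\<lambda>_. 0) \<and> sqrt N2 = (\<integral>X. f X \<partial>?P) / sqrt (\<integral>X. (f X)\<^sup>2 \<partial>?N)"
      using g by blast
  next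
    fix r assume "\<exists>f\<in>?V. f \<noteq> (\<lambda>_. 0) \<and> r = (\<integral>X. f X \<partial>?P) / sqrt (\<integral>X. (f X)\<^sup>2 \<partial>?N)"
    then obtain f where f: "f \<in> ?V" and r: "r = (\<integral>x. f x * g x \<partial>?N) / sqrt (\<integral>x. f x * f x \<partial>?N)"
      using planted by (auto simp: power2_eq_square)
    have "(\<integral>x. f x * g x \<partial>?N)\<^sup>2 \<le> (\<integral>x. f x * f x \<partial>?N) * (\<integral>x. g x * g x \<partial>?N)"
      using int[OF f f] int[OF g g] int[OF f g] gg N2 by (intro integral_mult_cauchy_schwarz) simp_all
    then have "\<bar>\<integral>x. f x * g x \<partial>?N\<bar> \<le> sqrt (\<integral>x. f x * f x \<partial>?N) * sqrt N2"
      unfolding gg by (metis real_sqrt_abs real_sqrt_le_mono real_sqrt_mult)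
    moreover have "0 \<le> (\<integral>x. f x * f x \<partial>?N)" by simp
    ultimately show "r \<le> sqrt N2"
    proof (cases "(\<integral>x. f x * f x \<partial>?N) = 0")
      case False
      then have "sqrt (\<integral>x. f x * f x \<partial>?N) > 0"
        by (simp add: less_le)
      then show ?thesis
        using \<open>\<bar>_\<bar> \<le> _\<close> unfolding r by (simp add: pos_divide_le_eq mult.commute abs_le_iff)
    qed (use N2 in \<open>simp add: r\<close>)
  qed
qed

section \<open>Moments of linear combinations of independent signs\<close>

text \<open>
The coefficient of \<open>x ^ m\<close> in \<open>exp (v * x^2 / 2)\<close>, so for \<open>v \<ge> 0\<close> the \<open>m\<close>-th moment of a centred
Gaussian of variance \<open>v\<close> is \<open>m!\<close> times it.
\<close>

definition gauss_coeff :: "real \<Rightarrow> nat \<Rightarrow> real" where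
  "gauss_coeff v m = (if even m then v ^ (m div 2) / (2 ^ (m div 2) * fact (m div 2)) else 0)"

lemma gauss_coeff_nonneg: "v \<ge> 0 \<Longrightarrow> gauss_coeff v m \<ge> 0"
  by (simp add: gauss_coeff_def)

lemma sum_even_atMost:
  fixes f :: "nat \<Rightarrow> real"
  shows "(\<Sum>d\<le>D. if even d then f (d div 2) else 0) = (\<Sum>k\<le>D div 2. f k)"
proof -
  have bij: "bij_betw (\<lambda>k. 2 * k) {..D div 2} {d \<in> {..D}. even d}"
    by (rule bij_betw_byWitness[of _ "\<lambda>d. d div 2"]) auto
  have "(\<Sum>d\<le>D. if even d then f (d div 2) else 0) = (\<Sum>d\<in>{d \<in> {..D}. even d}. f (d div 2))"
    by (rule sum.inter_filter[symmetric]) simp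
  also have "\<dots> = (\<Sum>k\<le>D div 2. f k)"
    by (subst sum.reindex_bij_betw[OF bij, symmetric]) simp
  finally show ?thesis .
qed

text \<open>
This is \<open>exp ((v + w) * x^2 / 2) = exp (v * x^2 / 2) * exp (w * x^2 / 2)\<close>, read off coefficientwise.
\<close>

lemma gauss_coeff_add:
  "gauss_coeff (v + w) m = (\<Sum>j\<le>m. gauss_coeff v j * gauss_coeff w (m - j))"
proof (cases "even m")
  case False
  then have "gauss_coeff v j * gauss_coeff w (m - j) = 0" if "j \<le> m" for j
    using that by (auto simp: gauss_coeff_def)
  then have "(\<Sum>j\<le>m. gauss_coeff v j * gauss_coeff w (m - j)) = 0" by (intro sum.neutral) simp
  then show ?thesis using False by (simp add: gauss_coeff_def)
next
  case True
  then obtain k where m: "m = 2 * k" by (elim evenE)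
  let ?h = "\<lambda>i. v ^ i / (2 ^ i * fact i) * (w ^ (k - i) / (2 ^ (k - i) * fact (k - i)))"
  have "(\<Sum>j\<le>m. gauss_coeff v j * gauss_coeff w (m - j)) =
      (\<Sum>j\<le>m. if even j then ?h (j div 2) else 0)"
  proof (intro sum.cong refl)
    fix j assume j: "j \<in> {..m}"
    show "gauss_coeff v j * gauss_coeff w (m - j) = (if even j then ?h (j div 2) else 0)"
    proof (cases "even j")
      case True
      then obtain i where "j = 2 * i" by (elim evenE)
      then show ?thesis using j m by (simp add: gauss_coeff_def flip: diff_mult_distrib2)
    qed (simp add: gauss_coeff_def)
  qed
  also have "\<dots> = (\<Sum>i\<le>k. ?h i)" using sum_even_atMost[of ?h m] by (simp only: m) simp
  also have "\<dots> = (\<Sum>i\<le>k. real (k choose i) * v ^ i * w ^ (k - i)) / (2 ^ k * fact k)"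
    unfolding sum_divide_distrib
  proof (intro sum.cong refl)
    fix i assume "i \<in> {..k}"
    then have "(2::real) ^ k = 2 ^ i * 2 ^ (k - i)" "i \<le> k" by (simp_all flip: power_add)
    then show "?h i = real (k choose i) * v ^ i * w ^ (k - i) / (2 ^ k * fact k)"
      by (simp add: binomial_fact field_simps)
  qed
  also have "\<dots> = gauss_coeff (v + w) m"
    by (simp add: gauss_coeff_def m binomial_ring)
  finally show ?thesis ..
qed

lemma pow2_fact_le_fact_double: "2 ^ k * fact k \<le> (fact (2 * k) :: real)"
proof (induction k)
  case (Suc k)
  have "2 ^ Suc k * fact (Suc k) = (2 * real k + 2) * (2 ^ k * fact k)" by (simp add: algebra_simps)
  also have "\<dots> \<le> (2 * real k + 2) * ((2 * real k + 1) * fact (2 * k))"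
  proof (intro mult_left_mono)
    have "2 ^ k * fact k \<le> 1 * (fact (2 * k) :: real)" using Suc by simp
    also have "\<dots> \<le> (2 * real k + 1) * fact (2 * k)" by (intro mult_right_mono) auto
    finally show "2 ^ k * fact k \<le> (2 * real k + 1) * (fact (2 * k) :: real)" .
  qed simp
  also have "\<dots> = fact (2 * Suc k)" by (simp add: algebra_simps)
  finally show ?case .
qed simp

text \<open>
The Taylor coefficients of \<open>cosh (t * x)\<close> lie between those of \<open>0\<close> and \<open>exp (t^2 * x^2 / 2)\<close>.
\<close>

lemma cosh_coeff_bounds:
  fixes t :: real
  shows "0 \<le> (t ^ m + (- t) ^ m) / 2 / fact m" "(t ^ m + (- t) ^ m) / 2 / fact m \<le> gauss_coeff (t\<^sup>2) m"
proof -
  have "0 \<le> (t ^ m + (- t) ^ m) / 2 / fact m \<and> (t ^ m + (- t) ^ m) / 2 / fact m \<le> gauss_coeff (t\<^sup>2) m"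
  proof (cases "even m")
    case False
    then show ?thesis by (simp add: gauss_coeff_def)
  next
    case True
    then obtain k where m: "m = 2 * k" by (elim evenE)
    have "t ^ (2 * k) / fact (2 * k) \<le> t ^ (2 * k) / (2 ^ k * fact k)"
      using pow2_fact_le_fact_double[of k] by (intro divide_left_mono) auto
    then show ?thesis by (simp add: m gauss_coeff_def power_mult)
  qed
  then show "0 \<le> (t ^ m + (- t) ^ m) / 2 / fact m" "(t ^ m + (- t) ^ m) / 2 / fact m \<le> gauss_coeff (t\<^sup>2) m"
    by blast+
qed

lemma expectation_pair_pmf_finite:
  fixes h :: "'a \<times> 'b \<Rightarrow> real"
  assumes "finite (set_pmf p)" "finite (set_pmf q)"
  shows "measure_pmf.expectation (pair_pmf p q) h =
    measure_pmf.expectation p (\<lambda>a. measure_pmf.expectation q (\<lambda>b. h (a, b)))"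
proof -
  have "measure_pmf.expectation (pair_pmf p q) h =
      (\<Sum>y\<in>set_pmf p \<times> set_pmf q. h y * pmf (pair_pmf p q) y)"
    using assms by (intro integral_measure_pmf_real) auto
  also have "\<dots> = (\<Sum>a\<in>set_pmf p. (\<Sum>b\<in>set_pmf q. h (a, b) * pmf q b) * pmf p a)"
    by (simp add: sum.cartesian_product' pmf_pair sum_distrib_left mult_ac case_prod_unfold)
  also have "\<dots> = measure_pmf.expectation p (\<lambda>a. measure_pmf.expectation q (\<lambda>b. h (a, b)))"
    using assms by (subst (1 2) integral_measure_pmf_real) auto
  finally show ?thesis .
qed

lemma set_rademacher_pmf [simp]: "set_pmf rademacher_pmf = {-1, 1}"
  by (simp add: rademacher_pmf_def)

lemma expectation_rademacher:
  fixes h :: "real \<Rightarrow> real"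
  shows "measure_pmf.expectation rademacher_pmf h = (h 1 + h (-1)) / 2"
  by (simp add: rademacher_pmf_def integral_pmf_of_set)

lemma finite_set_Pi_pmf:
  assumes "finite I" "\<And>i. i \<in> I \<Longrightarrow> finite (set_pmf (p i))"
  shows "finite (set_pmf (Pi_pmf I d p))"
  unfolding set_Pi_pmf[OF assms(1)] using assms by (intro finite_PiE_dflt) auto

abbreviation scaled_signs :: "'k set \<Rightarrow> ('k \<Rightarrow> real) \<Rightarrow> ('k \<Rightarrow> real) pmf" where
  "scaled_signs I a \<equiv> Pi_pmf I 0 (\<lambda>i. map_pmf (\<lambda>r. a i * r) rademacher_pmf)"

lemma finite_set_scaled_signs: "finite I \<Longrightarrow> finite (set_pmf (scaled_signs I a))"
  by (rule finite_set_Pi_pmf) auto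

text \<open>
Dividing by \<open>m!\<close> makes the moments the coefficients of a generating function, which is multiplicative
over the independent summands. Adding one sign multiplies it by a hyperbolic cosine, whose
coefficients are nonnegative and at most Gaussian. Nonnegativity is part of the induction,
since upper bounds can only be multiplied for nonnegative factors.
\<close>

lemma scaled_signs_moment:
  fixes a c :: "'k \<Rightarrow> real"
  assumes "finite I"
  shows "0 \<le> measure_pmf.expectation (scaled_signs I a) (\<lambda>x. (\<Sum>i\<in>I. c i * x i) ^ m) / fact m"
    and "measure_pmf.expectation (scaled_signs I a) (\<lambda>x. (\<Sum>i\<in>I. c i * x i) ^ m) / fact m
      \<le> gauss_coeff (\<Sum>i\<in>I. (c i * a i)\<^sup>2) m"
proof -
  define W where "W = (\<lambda>I m. measure_pmf.expectation (scaled_signs I a) (\<lambda>x. (\<Sum>i\<in>I. c i * x i) ^ m) / fact m)"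
  have "0 \<le> W I m \<and> W I m \<le> gauss_coeff (\<Sum>i\<in>I. (c i * a i)\<^sup>2) m" using assms
  proof (induction I arbitrary: m rule: finite_induct)
    case empty
    show ?case by (cases "m = 0") (auto simp: W_def gauss_coeff_def power_0_left)
  next
    case (insert i I)
    let ?t = "c i * a i"
    let ?C = "\<lambda>m. (?t ^ m + (- ?t) ^ m) / 2 / fact m"
    note fin = finite_set_scaled_signs[OF insert.hyps(1), of a]
    have int: "integrable (measure_pmf (scaled_signs I a)) f" for f :: "_ \<Rightarrow> real"
      by (rule integrable_measure_pmf_finite[OF fin])
    have bin: "measure_pmf.expectation (scaled_signs I a) (\<lambda>x. ((\<Sum>k\<in>I. c k * x k) + u) ^ m) =
        (\<Sum>j\<le>m. real (m choose j) * (W I j * fact j) * u ^ (m - j))" for u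
      unfolding binomial_ring W_def using int by (subst Bochner_Integration.integral_sum) auto
    have upd: "(\<Sum>k\<in>insert i I. c k * (x(i := y)) k) = (\<Sum>k\<in>I. c k * x k) + c i * y" for x :: "'k \<Rightarrow> real" and y
    proof -
      have "(\<Sum>k\<in>I. c k * (x(i := y)) k) = (\<Sum>k\<in>I. c k * x k)"
        using insert.hyps by (intro sum.cong) auto
      then show ?thesis using insert.hyps by (simp add: add.commute)
    qed
    have "W (insert i I) m = measure_pmf.expectation rademacher_pmf
        (\<lambda>r. measure_pmf.expectation (scaled_signs I a) (\<lambda>x. ((\<Sum>k\<in>I. c k * x k) + c i * (a i * r)) ^ m)) / fact m"
      unfolding W_def Pi_pmf_insert[OF insert.hyps] integral_map_pmf case_prod_unfold
      using fin by (subst expectation_pair_pmf_finite) (simp_all add: upd del: fun_upd_apply)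
    also have "\<dots> = ((\<Sum>j\<le>m. real (m choose j) * (W I j * fact j) * ?t ^ (m - j)) +
        (\<Sum>j\<le>m. real (m choose j) * (W I j * fact j) * (- ?t) ^ (m - j))) / 2 / fact m"
      by (simp add: expectation_rademacher bin flip: bin)
    also have "\<dots> = (\<Sum>j\<le>m. W I j * ?C (m - j))"
      unfolding sum.distrib[symmetric] sum_divide_distrib
      by (intro sum.cong refl) (simp add: binomial_fact field_simps)
    finally have W: "W (insert i I) m = (\<Sum>j\<le>m. W I j * ?C (m - j))" .
    have "0 \<le> W (insert i I) m"
      unfolding W by (intro sum_nonneg mult_nonneg_nonneg cosh_coeff_bounds) (simp add: insert.IH)
    moreover have "W (insert i I) m \<le> (\<Sum>j\<le>m. gauss_coeff (\<Sum>i\<in>I. (c i * a i)\<^sup>2) j * gauss_coeff (?t\<^sup>2) (m - j))"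
      unfolding W
      by (intro sum_mono mult_mono cosh_coeff_bounds gauss_coeff_nonneg sum_nonneg)
         (simp_all add: insert.IH)
    ultimately show ?case
      using insert.hyps by (simp add: add.commute flip: gauss_coeff_add)
  qed
  then show "0 \<le> measure_pmf.expectation (scaled_signs I a) (\<lambda>x. (\<Sum>i\<in>I. c i * x i) ^ m) / fact m"
    and "measure_pmf.expectation (scaled_signs I a) (\<lambda>x. (\<Sum>i\<in>I. c i * x i) ^ m) / fact m
      \<le> gauss_coeff (\<Sum>i\<in>I. (c i * a i)\<^sup>2) m"
    by (simp_all add: W_def)
qed

section \<open>Moments of the overlap of two random subsets\<close>

text \<open>
The ratio of consecutive values is \<open>(s - j) / (p - j) \<le> s / p\<close>.
\<close>

lemma binomial_diff_le:
  assumes "j \<le> s" "s \<le> p"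
  shows "real ((p - j) choose (s - j)) \<le> real (p choose s) * (real s / real p) ^ j"
  using assms(1)
proof (induction j)
  case (Suc j)
  have js: "j < s" and jp: "j < p" using Suc.prems assms(2) by auto
  have "(s - j) * ((p - j) choose (s - j)) = (p - j) * ((p - Suc j) choose (s - Suc j))"
    using binomial_absorption[of "s - Suc j" "p - j"] js jp by (simp add: Suc_diff_Suc)
  then have "real (s - j) * real ((p - j) choose (s - j)) = real (p - j) * real ((p - Suc j) choose (s - Suc j))"
    by (metis of_nat_mult)
  then have "real ((p - Suc j) choose (s - Suc j)) = (real (s - j) / real (p - j)) * real ((p - j) choose (s - j))"
    using jp by (simp add: field_simps)
  also have "\<dots> \<le> (real s / real p) * (real (p choose s) * (real s / real p) ^ j)"
  proof (intro mult_mono)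
    have "real j * real s \<le> real j * real p" using assms(2) by (intro mult_left_mono) auto
    then have "(real s - real j) * real p \<le> real s * (real p - real j)" by (simp add: algebra_simps)
    then show "real (s - j) / real (p - j) \<le> real s / real p"
      using js jp by (simp add: of_nat_diff field_simps)
    show "real ((p - j) choose (s - j)) \<le> real (p choose s) * (real s / real p) ^ j"
      using Suc.IH js by simp
  qed auto
  finally show ?case by (simp add: mult_ac)
qed simp

text \<open>
A uniformly random \<open>s\<close>-subset contains \<open>A\<close> with probability at most \<open>(s / p) ^ card A\<close>: sampling without
replacement is negatively correlated.
\<close>

lemma card_supersets_le:
  assumes P: "finite P" "s \<le> card P"
  shows "real (card {S. S \<subseteq> P \<and> card S = s \<and> A \<subseteq> S}) \<le>
    real (card P choose s) * (real s / real (card P)) ^ card A"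
proof (cases "A \<subseteq> P \<and> card A \<le> s")
  case True
  then have A: "A \<subseteq> P" "card A \<le> s" "finite A" using P finite_subset by auto
  have "{S. S \<subseteq> P \<and> card S = s \<and> A \<subseteq> S} \<subseteq> (\<lambda>B. A \<union> B) ` {B. B \<subseteq> P - A \<and> card B = s - card A}"
  proof
    fix S assume "S \<in> {S. S \<subseteq> P \<and> card S = s \<and> A \<subseteq> S}"
    then have "S = A \<union> (S - A)" "S - A \<subseteq> P - A" "card (S - A) = s - card A"
      using A by (auto simp: card_Diff_subset)
    then show "S \<in> (\<lambda>B. A \<union> B) ` {B. B \<subseteq> P - A \<and> card B = s - card A}" by blast
  qed
  then have "card {S. S \<subseteq> P \<and> card S = s \<and> A \<subseteq> S} \<le> card {B. B \<subseteq> P - A \<and> card B = s - card A}"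
    using P by (intro surj_card_le) auto
  also have "\<dots> = (card P - card A) choose (s - card A)"
    using A P by (simp add: n_subsets card_Diff_subset)
  finally show ?thesis
    using binomial_diff_le[OF A(2) P(2)] by linarith
next
  case False
  have "{S. S \<subseteq> P \<and> card S = s \<and> A \<subseteq> S} = {}"
  proof (rule ccontr)
    assume "{S. S \<subseteq> P \<and> card S = s \<and> A \<subseteq> S} \<noteq> {}"
    then obtain S where S: "S \<subseteq> P" "card S = s" "A \<subseteq> S" by auto
    then have "card A \<le> s" using P finite_subset card_mono by metis
    then show False using S False by auto
  qed
  then show ?thesis by (simp del: Collect_empty_eq)
qed

text \<open>
Restricting to supersets of \<open>A\<close> makes an induction on \<open>k\<close> possible: one factor \<open>card (S \<inter> T)\<close> is a sum
over \<open>t \<in> T\<close> of the condition \<open>t \<in> S\<close>, which replaces \<open>A\<close> by \<open>insert t A\<close>. The at most \<open>card A\<close> points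
\<open>t \<in> A\<close> impose nothing new, and each of the others costs a factor \<open>q\<close>; so a step multiplies the bound
by at most \<open>card A + s * q\<close>. This yields the moment bound without Stirling numbers.
\<close>

lemma overlap_moment_superset:
  assumes P: "finite P" "s \<le> card P" and T: "finite T" "card T \<le> s" and A: "finite A"
  defines "q \<equiv> real s / real (card P)"
  shows "(\<Sum>S | S \<subseteq> P \<and> card S = s \<and> A \<subseteq> S. real (card (S \<inter> T)) ^ k) \<le>
    real (card P choose s) * q ^ card A * (real s * q + real (card A) + real k) ^ k"
  using A
proof (induction k arbitrary: A)
  case 0
  then show ?case using card_supersets_le[OF P] by (simp add: q_def)
next
  case (Suc k)
  let ?C = "real (card P choose s)" and ?X = "real s * q + real (card A) + real (Suc k)"
  let ?F = "\<lambda>A. {S. S \<subseteq> P \<and> card S = s \<and> A \<subseteq> S}"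
  have q0: "q \<ge> 0" by (simp add: q_def)
  have fin: "finite (?F A)" for A
    by (rule finite_subset[of _ "Pow P"]) (use P in auto)
  have step: "(\<Sum>S\<in>?F (insert t A). real (card (S \<inter> T)) ^ k) \<le>
      ?C * q ^ card A * (if t \<in> A then 1 else q) * ?X ^ k" for t
  proof -
    have "(\<Sum>S\<in>?F (insert t A). real (card (S \<inter> T)) ^ k) \<le>
        ?C * q ^ card (insert t A) * (real s * q + real (card (insert t A)) + real k) ^ k"
      using Suc by blast
    also have "\<dots> \<le> ?C * q ^ card (insert t A) * ?X ^ k"
      using q0 Suc.prems by (intro mult_left_mono power_mono) (auto simp: card_insert_if)
    also have "\<dots> = ?C * q ^ card A * (if t \<in> A then 1 else q) * ?X ^ k"
      using Suc.prems by (simp add: insert_absorb)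
    finally show ?thesis .
  qed
  have "(\<Sum>S\<in>?F A. real (card (S \<inter> T)) ^ Suc k) = (\<Sum>S\<in>?F A. \<Sum>t\<in>T. if t \<in> S then real (card (S \<inter> T)) ^ k else 0)"
    using T by (simp add: sum.If_cases Int_commute Int_def)
  also have "\<dots> = (\<Sum>t\<in>T. \<Sum>S\<in>?F A. if t \<in> S then real (card (S \<inter> T)) ^ k else 0)"
    by (rule sum.swap)
  also have "\<dots> = (\<Sum>t\<in>T. \<Sum>S\<in>?F (insert t A). real (card (S \<inter> T)) ^ k)"
  proof (rule sum.cong)
    fix t assume "t \<in> T"
    have "?F (insert t A) = {S \<in> ?F A. t \<in> S}" by auto
    then show "(\<Sum>S\<in>?F A. if t \<in> S then real (card (S \<inter> T)) ^ k else 0) = (\<Sum>S\<in>?F (insert t A). real (card (S \<inter> T)) ^ k)"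
      using sum.inter_filter[OF fin[of A], of "\<lambda>S. real (card (S \<inter> T)) ^ k" "\<lambda>S. t \<in> S"] by simp
  qed simp
  also have "\<dots> \<le> (\<Sum>t\<in>T. ?C * q ^ card A * (if t \<in> A then 1 else q) * ?X ^ k)"
    by (intro sum_mono step)
  also have "\<dots> = ?C * q ^ card A * (\<Sum>t\<in>T. if t \<in> A then 1 else q) * ?X ^ k"
    by (simp add: sum_distrib_left sum_distrib_right)
  also have "\<dots> \<le> ?C * q ^ card A * ?X * ?X ^ k"
  proof (intro mult_right_mono mult_left_mono)
    have "(\<Sum>t\<in>T. if t \<in> A then 1 else q) \<le> (\<Sum>t\<in>T. (if t \<in> A then 1 else 0) + q)"
      using q0 by (intro sum_mono) auto
    also have "\<dots> = real (card (T \<inter> A)) + real (card T) * q"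
      using T by (simp add: sum.distrib sum.If_cases)
    also have "\<dots> \<le> real (card A) + real s * q"
      using T q0 Suc.prems by (intro add_mono mult_right_mono) (auto intro: card_mono)
    finally show "(\<Sum>t\<in>T. if t \<in> A then 1 else q) \<le> ?X" by simp
  qed (use q0 in auto)
  finally show ?case by (simp add: mult.assoc)
qed

lemma overlap_moment:
  assumes "finite P" "s \<le> card P" "finite T" "card T \<le> s"
  shows "(\<Sum>S | S \<subseteq> P \<and> card S = s. real (card (S \<inter> T)) ^ k) / real (card P choose s) \<le>
    ((real s)\<^sup>2 / real (card P) + real k) ^ k"
proof -
  have "real (card P choose s) > 0" using assms by simp
  then show ?thesis
    using overlap_moment_superset[OF assms, of "{}" k]
    by (simp add: field_simps power2_eq_square)
qed

section \<open>Overlaps of the labels and of the signals\<close>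

text \<open>
For a fixed first copy \<open>z\<close> the inner product is a sum of \<open>n\<close> signs with coefficients \<open>z i\<close> of square 1.
\<close>

lemma label_overlap_moment:
  shows "0 \<le> replica_moment {..<n} (label_prior n) d"
    and "replica_moment {..<n} (label_prior n) d \<le> gauss_coeff (real n) d"
proof -
  have lp: "label_prior n = scaled_signs {..<n} (\<lambda>_. 1)"
    by (simp add: label_prior_def map_pmf_ident)
  have fin: "finite (set_pmf (label_prior n))"
    unfolding lp by (rule finite_set_scaled_signs) simp
  have "0 \<le> measure_pmf.expectation (label_prior n) (\<lambda>z'. (\<Sum>i<n. z i * z' i) ^ d) / fact d \<and>
      measure_pmf.expectation (label_prior n) (\<lambda>z'. (\<Sum>i<n. z i * z' i) ^ d) / fact d \<le> gauss_coeff (real n) d"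
    if "z \<in> set_pmf (label_prior n)" for z
  proof -
    have "(z i)\<^sup>2 = 1" if "i < n" for i
      using \<open>z \<in> _\<close> that by (auto simp: label_prior_def set_Pi_pmf PiE_dflt_def)
    then have "(\<Sum>i<n. (z i * 1)\<^sup>2) = real n" by simp
    then show ?thesis
      using scaled_signs_moment[of "{..<n}" "\<lambda>_. 1" z d] by (simp add: lp)
  qed
  then have "AE z in label_prior n. 0 \<le> measure_pmf.expectation (label_prior n) (\<lambda>z'. (\<Sum>i<n. z i * z' i) ^ d) / fact d"
    and "AE z in label_prior n. measure_pmf.expectation (label_prior n) (\<lambda>z'. (\<Sum>i<n. z i * z' i) ^ d) / fact d \<le> gauss_coeff (real n) d"
    by (auto simp: AE_measure_pmf_iff)
  from measure_pmf.integral_ge_const[OF integrable_measure_pmf_finite[OF fin] this(1)]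
    measure_pmf.integral_le_const[OF integrable_measure_pmf_finite[OF fin] this(2)]
  show "0 \<le> replica_moment {..<n} (label_prior n) d"
    and "replica_moment {..<n} (label_prior n) d \<le> gauss_coeff (real n) d"
    by (simp_all add: replica_moment_def)
qed

text \<open>
Given its support \<open>S\<close>, the signal consists of independent signs with these scales. Using the scale 0 off
the support puts the constant coordinates into the same form as the random ones.
\<close>

definition signal_scale :: "nat \<Rightarrow> real \<Rightarrow> nat set \<Rightarrow> nat \<Rightarrow> real" where
  "signal_scale s \<Delta> S j = (if j \<in> S then \<Delta> / sqrt (real s) else 0)"

lemma expectation_signal_prior:
  fixes h :: "(nat \<Rightarrow> real) \<Rightarrow> real"
  assumes "s \<le> p"
  shows "measure_pmf.expectation (signal_prior p s \<Delta>) h =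
      (\<Sum>S | S \<subseteq> {..<p} \<and> card S = s. measure_pmf.expectation (scaled_signs {..<p} (signal_scale s \<Delta> S)) h) / real (p choose s)"
    and "finite (set_pmf (signal_prior p s \<Delta>))"
    and "set_pmf (signal_prior p s \<Delta>) =
      (\<Union>S\<in>{S. S \<subseteq> {..<p} \<and> card S = s}. set_pmf (scaled_signs {..<p} (signal_scale s \<Delta> S)))"
proof -
  let ?F = "{S. S \<subseteq> {..<p} \<and> card S = s}"
  have zero: "map_pmf ((*) 0) rademacher_pmf = return_pmf (0::real)"
    using map_pmf_const[of 0 rademacher_pmf] by (simp add: mult_zero_left[abs_def])
  have comp: "(if j \<in> S then map_pmf (\<lambda>r. \<Delta> / sqrt (real s) * r) rademacher_pmf else return_pmf 0) =
      map_pmf (\<lambda>r. signal_scale s \<Delta> S j * r) rademacher_pmf" for j S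
    by (simp add: signal_scale_def zero)
  have sp: "signal_prior p s \<Delta> = pmf_of_set ?F \<bind> (\<lambda>S. scaled_signs {..<p} (signal_scale s \<Delta> S))"
    unfolding signal_prior_def comp ..
  have finF: "finite ?F" by (rule finite_subset[of _ "Pow {..<p}"]) auto
  have cardF: "card ?F = p choose s" using n_subsets[of "{..<p}" s] by simp
  have neF: "?F \<noteq> {}"
  proof
    assume "?F = {}"
    then have "p choose s = 0" using cardF by (metis card.empty)
    then show False using assms by simp
  qed
  show "measure_pmf.expectation (signal_prior p s \<Delta>) h =
      (\<Sum>S\<in>?F. measure_pmf.expectation (scaled_signs {..<p} (signal_scale s \<Delta> S)) h) / real (p choose s)"
    unfolding sp
    by (subst pmf_expectation_bind_pmf_of_set[OF neF finF])
       (simp_all add: finite_set_scaled_signs cardF divide_inverse mult.commute sum_distrib_left)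
  show un: "set_pmf (signal_prior p s \<Delta>) = (\<Union>S\<in>?F. set_pmf (scaled_signs {..<p} (signal_scale s \<Delta> S)))"
    unfolding sp set_bind_pmf set_pmf_of_set[OF neF finF] ..
  show "finite (set_pmf (signal_prior p s \<Delta>))"
    unfolding un using finF by (intro finite_UN_I finite_set_scaled_signs) auto
qed

text \<open>
For a fixed first copy with support \<open>T\<close> and a second copy with support \<open>S\<close>, the inner product is a
combination of signs of total variance \<open>\<Delta>^4 / s^2 * card (S \<inter> T)\<close>. Averaging the Gaussian bound over \<open>S\<close>
leaves the moments of the overlap, whose bound depends on \<open>T\<close> only through its size.
\<close>

lemma signal_overlap_moment:
  assumes s: "1 \<le> s" "s \<le> p"
  shows "0 \<le> replica_moment {..<p} (signal_prior p s \<Delta>) d"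
    and "replica_moment {..<p} (signal_prior p s \<Delta>) d \<le> gauss_coeff (\<Delta> ^ 4 / real p + \<Delta> ^ 4 / (real s)\<^sup>2 * real (d div 2)) d"
proof -
  let ?F = "{S. S \<subseteq> {..<p} \<and> card S = s}"
  let ?E = "measure_pmf.expectation (signal_prior p s \<Delta>)"
  let ?v = "\<Delta> ^ 4 / real p + \<Delta> ^ 4 / (real s)\<^sup>2 * real (d div 2)"
  note prior = expectation_signal_prior[OF s(2), of \<Delta>]
  have C: "real (p choose s) > 0" using s by simp
  have a2: "(signal_scale s \<Delta> S j)\<^sup>2 = (if j \<in> S then \<Delta>\<^sup>2 / real s else 0)" for S j
    by (simp add: signal_scale_def power_divide)
  have "0 \<le> ?E (\<lambda>\<theta>'. (\<Sum>j<p. \<theta> j * \<theta>' j) ^ d) / fact d \<and>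
      ?E (\<lambda>\<theta>'. (\<Sum>j<p. \<theta> j * \<theta>' j) ^ d) / fact d \<le> gauss_coeff ?v d"
    if \<theta>: "\<theta> \<in> set_pmf (signal_prior p s \<Delta>)" for \<theta>
  proof -
    obtain T where T: "T \<subseteq> {..<p}" "card T = s" "\<theta> \<in> set_pmf (scaled_signs {..<p} (signal_scale s \<Delta> T))"
      using \<theta> unfolding prior(3) by auto
    let ?W = "\<lambda>S. measure_pmf.expectation (scaled_signs {..<p} (signal_scale s \<Delta> S)) (\<lambda>\<theta>'. (\<Sum>j<p. \<theta> j * \<theta>' j) ^ d) / fact d"
    have avg: "?E (\<lambda>\<theta>'. (\<Sum>j<p. \<theta> j * \<theta>' j) ^ d) / fact d = (\<Sum>S\<in>?F. ?W S) / real (p choose s)"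
      unfolding prior(1) sum_divide_distrib by (intro sum.cong refl) simp
    have sq: "(\<theta> j)\<^sup>2 = (signal_scale s \<Delta> T j)\<^sup>2" if "j < p" for j
      using T(3) that by (auto simp: set_Pi_pmf PiE_dflt_def)
    \<comment> \<open>The squared entry \<open>\<Delta>^2 / s\<close> enters once from each copy.\<close>
    have scale: "\<Delta>\<^sup>2 / real s * (\<Delta>\<^sup>2 / real s) = \<Delta> ^ 4 / (real s)\<^sup>2"
      by (simp add: power2_eq_square power4_eq_xxxx)
    have var: "(\<Sum>j<p. (\<theta> j * signal_scale s \<Delta> S j)\<^sup>2) = \<Delta> ^ 4 / (real s)\<^sup>2 * real (card (S \<inter> T))" if "S \<in> ?F" for S
    proof -
      have "(\<Sum>j<p. (\<theta> j * signal_scale s \<Delta> S j)\<^sup>2) = (\<Sum>j<p. if j \<in> S \<inter> T then \<Delta> ^ 4 / (real s)\<^sup>2 else 0)"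
        using scale by (intro sum.cong refl) (simp add: power_mult_distrib sq a2)
      also have "\<dots> = (\<Sum>j\<in>S \<inter> T. \<Delta> ^ 4 / (real s)\<^sup>2)"
        using T(1) by (intro sum.mono_neutral_cong_right) auto
      finally show ?thesis by simp
    qed
    have W: "0 \<le> ?W S" "?W S \<le> gauss_coeff (\<Delta> ^ 4 / (real s)\<^sup>2 * real (card (S \<inter> T))) d" if "S \<in> ?F" for S
      using scaled_signs_moment[of "{..<p}" "signal_scale s \<Delta> S" \<theta> d] var[OF that] by simp_all
    have "0 \<le> (\<Sum>S\<in>?F. ?W S) / real (p choose s)"
      by (rule divide_nonneg_nonneg[OF sum_nonneg[OF W(1)]]) simp_all
    moreover have "(\<Sum>S\<in>?F. ?W S) / real (p choose s) \<le> gauss_coeff ?v d"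
    proof (cases "even d")
      case False
      then have "(\<Sum>S\<in>?F. ?W S) \<le> 0"
        using W(2) by (intro sum_nonpos) (auto simp: gauss_coeff_def)
      then show ?thesis using False C by (simp add: gauss_coeff_def divide_nonpos_pos)
    next
      case True
      then obtain k where d: "d = 2 * k" by (elim evenE)
      let ?c = "(\<Delta> ^ 4 / (real s)\<^sup>2) ^ k / (2 ^ k * fact k)"
      have "(\<Sum>S\<in>?F. ?W S) \<le> (\<Sum>S\<in>?F. ?c * real (card (S \<inter> T)) ^ k)"
      proof (rule sum_mono)
        fix S assume "S \<in> ?F"
        from W(2)[OF this] show "?W S \<le> ?c * real (card (S \<inter> T)) ^ k"
          by (simp add: gauss_coeff_def d power_mult_distrib power_divide)
      qed
      then have "(\<Sum>S\<in>?F. ?W S) / real (p choose s) \<le> ?c * ((\<Sum>S\<in>?F. real (card (S \<inter> T)) ^ k) / real (p choose s))"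
        unfolding sum_distrib_left[symmetric] times_divide_eq_right[symmetric, of ?c]
        by (simp only: times_divide_eq_right divide_right_mono of_nat_0_le_iff)
      also have "\<dots> \<le> ?c * ((real s)\<^sup>2 / real p + real k) ^ k"
        using overlap_moment[of "{..<p}" s T k] s T
        by (intro mult_left_mono) (auto intro: finite_subset)
      also have "\<dots> = (\<Delta> ^ 4 / (real s)\<^sup>2 * ((real s)\<^sup>2 / real p + real k)) ^ k / (2 ^ k * fact k)"
        by (simp only: power_mult_distrib) simp
      also have "\<Delta> ^ 4 / (real s)\<^sup>2 * ((real s)\<^sup>2 / real p + real k) = ?v"
        using s d by (simp add: distrib_left)
      finally show ?thesis by (simp add: gauss_coeff_def d)
    qed
    ultimately show ?thesis unfolding avg by blast
  qed
  then have "AE \<theta> in signal_prior p s \<Delta>. 0 \<le> ?E (\<lambda>\<theta>'. (\<Sum>j<p. \<theta> j * \<theta>' j) ^ d) / fact d"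
    and "AE \<theta> in signal_prior p s \<Delta>. ?E (\<lambda>\<theta>'. (\<Sum>j<p. \<theta> j * \<theta>' j) ^ d) / fact d \<le> gauss_coeff ?v d"
    by (auto simp: AE_measure_pmf_iff)
  from measure_pmf.integral_ge_const[OF integrable_measure_pmf_finite[OF prior(2)] this(1)]
    measure_pmf.integral_le_const[OF integrable_measure_pmf_finite[OF prior(2)] this(2)]
  show "0 \<le> replica_moment {..<p} (signal_prior p s \<Delta>) d"
    and "replica_moment {..<p} (signal_prior p s \<Delta>) d \<le> gauss_coeff ?v d"
    by (simp_all add: replica_moment_def)
qed

section \<open>The bound on the low-degree norm\<close>

lemma planted_dist_eq:
  "planted_dist n p s \<Delta> = planted_gauss (data_index n p) (pair_pmf (label_prior n) (signal_prior p s \<Delta>))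
     (\<lambda>(z, \<theta>) (i, j). z i * \<theta> j)"
  unfolding planted_dist_def planted_gauss_def null_dist_def translate_def
  by (intro arg_cong2[where f = "distr _"] refl) (auto simp: fun_eq_iff restrict_def)

text \<open>
The mean vector is the rank-one array \<open>z i * \<theta> j\<close>, so the inner product of two copies factors and the
replica moments multiply. The factor \<open>fact d\<close> compensates for each of them being divided by it.
\<close>

lemma low_degree_norm_squared:
  assumes "s \<le> p"
  shows "(low_degree_norm n p s \<Delta> D)\<^sup>2 = (\<Sum>d\<le>D. replica_moment {..<n} (label_prior n) d *
      replica_moment {..<p} (signal_prior p s \<Delta>) d * fact d)" (is ?eq)
    and "(low_degree_norm n p s \<Delta> D)\<^sup>2 \<ge> 1"
proof -
  let ?\<mu> = "pair_pmf (label_prior n) (signal_prior p s \<Delta>)" and ?v = "\<lambda>(z, \<theta>) (i, j). z i * \<theta> j :: real"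
  have finl: "finite (set_pmf (label_prior n))"
    unfolding label_prior_def by (rule finite_set_Pi_pmf) auto
  note fins = expectation_signal_prior(2)[OF assms(1), of \<Delta>]
  have fin: "finite (set_pmf ?\<mu>)" using finl fins by simp
  have inner: "(\<Sum>k\<in>data_index n p. ?v (z, \<theta>) k * ?v (z', \<theta>') k) = (\<Sum>i<n. z i * z' i) * (\<Sum>j<p. \<theta> j * \<theta>' j)"
    for z z' :: "nat \<Rightarrow> real" and \<theta> \<theta>' :: "nat \<Rightarrow> real"
    unfolding sum_product sum.cartesian_product by (intro sum.cong refl) (auto simp: mult_ac)
  have moment: "replica_moment (data_index n p) (map_pmf ?v ?\<mu>) d =
      replica_moment {..<n} (label_prior n) d * replica_moment {..<p} (signal_prior p s \<Delta>) d * fact d" for d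
    unfolding replica_moment_def integral_map_pmf expectation_pair_pmf_finite[OF finl fins] inner power_mult_distrib
    by simp
  have fd: "finite (data_index n p)" by simp
  note g = greatest_ratio_planted_gauss[OF fd fin, where v = ?v and D = D, unfolded moment]
  have "low_degree_norm n p s \<Delta> D = sqrt (\<Sum>d\<le>D. replica_moment {..<n} (label_prior n) d *
      replica_moment {..<p} (signal_prior p s \<Delta>) d * fact d)"
    using g(1) unfolding low_degree_norm_def planted_dist_eq null_dist_def .
  then show ?eq "(low_degree_norm n p s \<Delta> D)\<^sup>2 \<ge> 1" using g(2) by simp_all
qed

text \<open>
For \<open>d = 2 * k\<close> the constant on the left is \<open>(2 k choose k) / 4^k \<le> 1\<close>.
\<close>

lemma gauss_coeff_mult_le:
  assumes "0 \<le> v" "0 \<le> w"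
  shows "gauss_coeff v d * gauss_coeff w d * fact d \<le> (if even d then (v * w) ^ (d div 2) else 0)"
proof (cases "even d")
  case False
  then show ?thesis by (simp add: gauss_coeff_def)
next
  case True
  then obtain k where d: "d = 2 * k" by (elim evenE)
  have "real ((2 * k) choose k) \<le> real (2 ^ (2 * k))"
    using binomial_le_pow2[of "2 * k" k] by (simp only: of_nat_le_iff)
  then have "fact (2 * k) / (fact k * fact k) \<le> (2 ^ k * 2 ^ k :: real)"
    by (simp add: binomial_fact power_add mult_2)
  then have "fact (2 * k) \<le> (2 ^ k * fact k) * (2 ^ k * fact k :: real)"
    by (simp add: field_simps)
  then have "fact (2 * k) / ((2 ^ k * fact k) * (2 ^ k * fact k)) \<le> (1 :: real)"
    by simp
  then have "(v * w) ^ k * (fact (2 * k) / ((2 ^ k * fact k) * (2 ^ k * fact k))) \<le> (v * w) ^ k * 1"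
    using assms by (intro mult_left_mono) auto
  then show ?thesis by (simp add: gauss_coeff_def d power_mult_distrib mult_ac)
qed

text \<open>
Odd degrees contribute nothing and degree \<open>2 * k\<close> contributes at most \<open>x ^ k\<close>, so the squared norm is at
most a geometric series.
\<close>

lemma low_degree_norm_bound:
  fixes n D :: nat and \<Delta> :: real
  assumes s: "1 \<le> s" "s \<le> p"
  defines "x \<equiv> real n * \<Delta> ^ 4 / real p + real n * \<Delta> ^ 4 * real D / (real s)\<^sup>2"
  assumes x: "x < 1"
  shows "(low_degree_norm n p s \<Delta> D)\<^sup>2 - 1 \<le> x / (1 - x)"
proof -
  define A where "A = replica_moment {..<n} (label_prior n)"
  define B where "B = replica_moment {..<p} (signal_prior p s \<Delta>)"
  note A = label_overlap_moment[of n, folded A_def] and B = signal_overlap_moment[OF s, of \<Delta>, folded B_def]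
  let ?w = "\<lambda>d. \<Delta> ^ 4 / real p + \<Delta> ^ 4 / (real s)\<^sup>2 * real (d div 2)"
  have x0: "0 \<le> x" by (simp add: x_def)
  have term_le: "A d * B d * fact d \<le> (if even d then x ^ (d div 2) else 0)" if d: "d \<le> D" for d
  proof -
    have "A d * B d * fact d \<le> gauss_coeff (real n) d * gauss_coeff (?w d) d * fact d"
      using A B by (intro mult_right_mono mult_mono gauss_coeff_nonneg) auto
    also have "\<dots> \<le> (if even d then (real n * ?w d) ^ (d div 2) else 0)"
      by (rule gauss_coeff_mult_le) auto
    also have "\<dots> \<le> (if even d then x ^ (d div 2) else 0)"
    proof -
      have "real n * \<Delta> ^ 4 / (real s)\<^sup>2 * real (d div 2) \<le> real n * \<Delta> ^ 4 / (real s)\<^sup>2 * real D"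
        using d by (intro mult_left_mono) auto
      then have "real n * ?w d \<le> x" by (simp add: x_def distrib_left)
      then show ?thesis by (auto intro!: power_mono)
    qed
    finally show ?thesis .
  qed
  have "(low_degree_norm n p s \<Delta> D)\<^sup>2 = (\<Sum>d\<le>D. A d * B d * fact d)"
    unfolding low_degree_norm_squared(1)[OF s(2)] A_def B_def by simp
  also have "\<dots> \<le> (\<Sum>d\<le>D. if even d then x ^ (d div 2) else 0)"
    using term_le by (intro sum_mono) auto
  also have "\<dots> = (\<Sum>k\<le>D div 2. x ^ k)" by (rule sum_even_atMost)
  also have "\<dots> \<le> 1 / (1 - x)"
    using x x0 by (simp add: sum_gp0 divide_right_mono)
  finally show ?thesis using x by (simp add: field_simps)
qed

theorem theorem2p3:
  fixes p s D :: "nat \<Rightarrow> nat" and \<Delta> :: "nat \<Rightarrow> real"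
  assumes "\<And>n. n \<ge> 1 \<Longrightarrow> 1 \<le> s n \<and> s n \<le> p n"
    and "limsup (\<lambda>n. ereal (sqrt (real n * \<Delta> n ^ 4 / real (p n))
           + sqrt (4 * real n * \<Delta> n ^ 4 * real (D n) / (real (s n))\<^sup>2))) < 1"
  shows "(\<lambda>n. (low_degree_norm n (p n) (s n) (\<Delta> n) (D n))\<^sup>2 - 1)
           \<in> O(\<lambda>n. real n * \<Delta> n ^ 4 / real (p n)
                    + real n * \<Delta> n ^ 4 * real (D n) / (real (s n))\<^sup>2)"
proof -
  define a where "a = (\<lambda>n. real n * \<Delta> n ^ 4 / real (p n))"
  define b where "b = (\<lambda>n. real n * \<Delta> n ^ 4 * real (D n) / (real (s n))\<^sup>2)"
  have ab: "0 \<le> a n" "0 \<le> b n" for n by (simp_all add: a_def b_def)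
  have b4: "4 * real n * \<Delta> n ^ 4 * real (D n) / (real (s n))\<^sup>2 = 4 * b n" for n
    by (simp add: b_def)
  have lim: "limsup (\<lambda>n. ereal (sqrt (a n) + sqrt (4 * b n))) < 1"
    using assms(2) unfolding b4 a_def .
  then obtain \<rho> where \<rho>: "limsup (\<lambda>n. ereal (sqrt (a n) + sqrt (4 * b n))) < ereal \<rho>" "ereal \<rho> < 1"
    using ereal_dense2 by blast
  then have "\<rho> < 1" by simp
  have "\<forall>\<^sub>F n in sequentially. sqrt (a n) + sqrt (4 * b n) < \<rho>"
    using Limsup_lessD[OF \<rho>(1)] by simp
  then have "\<forall>\<^sub>F n in sequentially. norm ((low_degree_norm n (p n) (s n) (\<Delta> n) (D n))\<^sup>2 - 1)
      \<le> (1 / (1 - \<rho>\<^sup>2)) * norm (a n + b n)"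
    using eventually_ge_at_top[of 1]
  proof eventually_elim
    case (elim n)
    have s: "1 \<le> s n" "s n \<le> p n" using assms(1) elim(2) by auto
    \<comment> \<open>Squaring the hypothesis bounds the rate itself away from 1.\<close>
    have "a n + b n \<le> (sqrt (a n) + sqrt (4 * b n))\<^sup>2"
    proof -
      have "0 \<le> sqrt (a n) * sqrt (4 * b n)" using ab by simp
      then show ?thesis using ab[of n] by (simp add: power2_sum del: real_sqrt_ge_0_iff)
    qed
    also have "\<dots> \<le> \<rho>\<^sup>2" using elim(1) ab[of n] by (intro power_mono) auto
    finally have x: "a n + b n \<le> \<rho>\<^sup>2" .
    have "0 \<le> sqrt (a n) + sqrt (4 * b n)" using ab[of n] by simp
    then have "0 \<le> \<rho>" using elim(1) by linarith
    then have r1: "\<rho>\<^sup>2 < 1" using \<open>\<rho> < 1\<close> by (simp add: power_less_one_iff)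
    have "(low_degree_norm n (p n) (s n) (\<Delta> n) (D n))\<^sup>2 - 1 \<le> (a n + b n) / (1 - (a n + b n))"
      using low_degree_norm_bound[OF s, of n "\<Delta> n" "D n"] x r1 by (simp add: a_def b_def)
    also have "\<dots> \<le> (a n + b n) / (1 - \<rho>\<^sup>2)"
      using x r1 ab[of n] by (intro divide_left_mono) auto
    finally show ?case
      using low_degree_norm_squared(2)[OF s(2), of n "\<Delta> n" "D n"] ab[of n] by simp
  qed
  then have "(\<lambda>n. (low_degree_norm n (p n) (s n) (\<Delta> n) (D n))\<^sup>2 - 1) \<in> O(\<lambda>n. a n + b n)"
    by (rule bigoI)
  then show ?thesis by (simp add: a_def b_def)
qed

end
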